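(* Let $m\ge1$ be an integer and let $\lambda,\mu,\lambda',\mu'\in\mathbb{R}$ satisfy $\mu-\lambda=\mu'-\lambda'=\delta$. If $(m+1)\delta-m\notin\{1,2,3,\dots\}$, then a linear map $T:\mathcal{D}_{\lambda\mu}(\mathbb{R}^m)\to\mathcal{D}_{\lambda'\mu'}(\mathbb{R}^m)$ is $s\ell_{m+1}$-equivariant if and only if there exist constants $a_k\in\mathbb{R}$ such that, for each $k\in\mathbb{N}=\{0,1,2,\dots\}$, $$\sigma^{\lambda'\mu'}\circ T\circ(\sigma^{\lambda\mu})^{-1}=a_k\,\mathrm{id}$$ on $\mathcal{S}^k_\delta(\mathbb{R}^m)$.
   Context: $s\ell_{m+1}$ denotes the Lie subalgebra of the Lie algebra $Vect(\mathbb{R}^m)$ of smooth vector fields on $\mathbb{R}^m$ spanned by $\partial_i$, $x^j\partial_i$ and $x^jE$ ($1\le i,j\le m$), where $E=\sum_i x^i\partial_i$; it is isomorphic to $s\ell(m+1,\mathbb{R})$. The space of scalar $\lambda$-densities on $\mathbb{R}^m$ is identified with $C_\infty(\mathbb{R}^m)$ with Lie derivative $L^\lambda_Xf=X.f+\lambda\,\mathrm{tr}(DX)f$, where $X.f=\sum_iX^i\partial_if$ and $DX=(\partial_jX^i)$. $\mathcal{D}^k_{\lambda\mu}(\mathbb{R}^m)$ is the space of linear differential operators of order $\le k$ from $\lambda$-densities to $\mu$-densities and $\mathcal{D}_{\lambda\mu}(\mathbb{R}^m)=\bigcup_k\mathcal{D}^k_{\lambda\mu}(\mathbb{R}^m)$,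 with $X$ acting by $A\mapsto L^\mu_X\circ A-A\circ L^\lambda_X$. $\mathcal{S}^k_\delta(\mathbb{R}^m)$ is the space of smooth symmetric $k$-contravariant tensor fields on $\mathbb{R}^m$ with values in the $\delta$-densities. It is identified with $C_\infty(\mathbb{R}^m,\vee^k\mathbb{R}^m)$, with Lie derivative $L_XP=X.P-\rho(DX)P+\delta\,\mathrm{tr}(DX)P$, where $\rho$ is the natural representation of $g\ell(m,\mathbb{R})$ on $\vee^k\mathbb{R}^m$. $\mathcal{S}_\delta(\mathbb{R}^m)=\bigoplus_{k\ge0}\mathcal{S}^k_\delta(\mathbb{R}^m)$. The symbol map $\sigma:\mathcal{D}^k_{\lambda\mu}(\mathbb{R}^m)\to\mathcal{S}^k_\delta(\mathbb{R}^m)$ is $\sigma(\sum_{|\alpha|\le k}a_\alpha\partial^\alpha)(\xi)=\sum_{|\alpha|=k}a_\alpha\xi^\alpha$, viewing elements of $\vee^k\mathbb{R}^m$ as homogeneous polynomials in $\xi\in\mathbb{R}^{m*}$. When $(m+1)\delta-m\notin\{1,2,3,\dots\}$, $\sigma^{\lambda\mu}:\mathcal{D}_{\lambda\mu}(\mathbb{R}^m)\to\mathcal{S}_\delta(\mathbb{R}^m)$ denotes the unique (it exists) $s\ell_{m+1}$-equivariant linear bijection such that for each $k$ and each $A\in\mathcal{D}^k_{\lambda\mu}(\mathbb{R}^m)$, $\sigma^{\lambda\mu}(A)\in\bigoplus_{\ell\le k}\mathcal{S}^\ell_\delta(\mathbb{R}^m)$ has component $\sigma(A)$ in $\mathcal{S}^k_\delta(\mathbb{R}^m)$;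 similarly for $\sigma^{\lambda'\mu'}$. A linear map is $s\ell_{m+1}$-equivariant if it commutes with the actions of all $X\in s\ell_{m+1}$; no continuity or locality is assumed. *)

theory Defs
  imports "HOL-Analysis.Analysis" "HOL-Library.Function_Algebras"
begin

instantiation "fun" :: (type, real_vector) real_vector
begin

definition scaleR_fun :: "real \<Rightarrow> ('a \<Rightarrow> 'b) \<Rightarrow> 'a \<Rightarrow> 'b"
  where "c *\<^sub>R f = (\<lambda>x. c *\<^sub>R f x)"

instance
  by standard (simp_all add: scaleR_fun_def fun_eq_iff scaleR_add_right scaleR_add_left)

end

lemma scaleR_fun_apply [simp]: "(c *\<^sub>R f) x = c *\<^sub>R f x"
  by (simp add: scaleR_fun_def)

definition linear_map_on :: "'a::real_vector set \<Rightarrow> ('a \<Rightarrow> 'b::real_vector) \<Rightarrow> bool"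
  where "linear_map_on V T \<longleftrightarrow>
    (\<forall>u\<in>V. \<forall>v\<in>V. T (u + v) = T u + T v) \<and> (\<forall>c. \<forall>u\<in>V. T (c *\<^sub>R u) = c *\<^sub>R T u)"


section \<open>Smooth functions and multi-indices\<close>

type_synonym 'm scalar_field = "real ^ 'm \<Rightarrow> real"

definition pderivative :: "'m::finite \<Rightarrow> 'm scalar_field \<Rightarrow> 'm scalar_field"
  where "pderivative i f = (\<lambda>x. frechet_derivative f (at x) (axis i 1))"

text \<open>Being the greatest fixed point, the following says that all iterated partial derivatives
  of \<open>f\<close>, of every order, exist and are (Frechet) differentiable, i.e. that \<open>f\<close> is of
  class \<open>C\<^sup>\<infinity>\<close> on the whole space.\<close>

coinductive smooth :: "'m::finite scalar_field \<Rightarrow> bool"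
  where "(\<And>x. f differentiable (at x)) \<Longrightarrow> (\<And>i. smooth (pderivative i f)) \<Longrightarrow> smooth f"

text \<open>The index type carries no order, so the order in which the partial derivatives of
  \<open>\<partial>\<^sup>\<alpha>\<close> are taken is that of some fixed enumeration of it. On smooth functions the
  choice does not matter, by the symmetry of second derivatives.\<close>

definition index_list :: "'m::finite list"
  where "index_list = (SOME is. distinct is \<and> set is = UNIV)"

definition mderivative :: "('m::finite \<Rightarrow> nat) \<Rightarrow> 'm scalar_field \<Rightarrow> 'm scalar_field"
  where "mderivative \<alpha> f = foldr (\<lambda>i. pderivative i ^^ \<alpha> i) index_list f"

definition mdegree :: "('m::finite \<Rightarrow> nat) \<Rightarrow> nat"
  where "mdegree \<alpha> = (\<Sum>i\<in>UNIV. \<alpha> i)"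

definition monomial :: "('m::finite \<Rightarrow> nat) \<Rightarrow> real ^ 'm \<Rightarrow> real"
  where "monomial \<alpha> \<xi> = (\<Prod>i\<in>UNIV. (\<xi> $ i) ^ \<alpha> i)"

lemma index_list: "distinct (index_list :: 'm::finite list)" "set (index_list :: 'm list) = UNIV"
proof -
  have "\<exists>is::'m list. distinct is \<and> set is = UNIV"
    using finite_distinct_list[of "UNIV :: 'm set"] by auto
  then have "distinct (index_list :: 'm list) \<and> set (index_list :: 'm list) = UNIV"
    unfolding index_list_def by (rule someI_ex)
  then show "distinct (index_list :: 'm list)" "set (index_list :: 'm list) = UNIV" by auto
qed

lemma finite_mdegree_le: "finite {\<alpha> :: 'm::finite \<Rightarrow> nat. mdegree \<alpha> \<le> k}"
proof -
  have "\<alpha> i \<le> k" if "mdegree \<alpha> \<le> k" for \<alpha> :: "'m \<Rightarrow> nat" and i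
    using that member_le_sum[of i UNIV \<alpha>] by (simp add: mdegree_def)
  then have "{\<alpha> :: 'm \<Rightarrow> nat. mdegree \<alpha> \<le> k} \<subseteq> Pi\<^sub>E UNIV (\<lambda>_. {..k})"
    by auto
  then show ?thesis
    using finite_PiE[of UNIV "\<lambda>_::'m. {..k}"] by (auto intro: finite_subset)
qed

lemma finite_mdegree_eq: "finite {\<alpha> :: 'm::finite \<Rightarrow> nat. mdegree \<alpha> = k}"
  by (rule finite_subset[OF _ finite_mdegree_le[of k]]) auto


section \<open>Vector fields\<close>

type_synonym 'm vector_field = "real ^ 'm \<Rightarrow> real ^ 'm"

definition const_field :: "'m::finite \<Rightarrow> 'm vector_field"
  where "const_field i = (\<lambda>x. axis i 1)"

definition linear_field :: "'m::finite \<Rightarrow> 'm \<Rightarrow> 'm vector_field"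
  where "linear_field j i = (\<lambda>x. (x $ j) *\<^sub>R axis i 1)"

definition quadratic_field :: "'m::finite \<Rightarrow> 'm vector_field"
  where "quadratic_field j = (\<lambda>x. (x $ j) *\<^sub>R x)"

definition sl_fields :: "'m::finite vector_field set"
  where "sl_fields =
    span (range const_field \<union> (\<Union>j. range (linear_field j)) \<union> range quadratic_field)"

text \<open>\<open>jacobian X (at x) $ i $ j\<close> is the \<open>j\<close>-th partial derivative of the \<open>i\<close>-th component of \<open>X\<close>.\<close>

abbreviation divergence :: "'m::finite vector_field \<Rightarrow> 'm scalar_field"
  where "divergence X x \<equiv> trace (jacobian X (at x))"

definition deriv_along :: "'m::finite vector_field \<Rightarrow> 'm scalar_field \<Rightarrow> 'm scalar_field"
  where "deriv_along X f = (\<lambda>x. \<Sum>i\<in>UNIV. X x $ i * pderivative i f x)"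


section \<open>Densities and differential operators\<close>

definition lie_density :: "real \<Rightarrow> 'm::finite vector_field \<Rightarrow> 'm scalar_field \<Rightarrow> 'm scalar_field"
  where "lie_density lam X f = (\<lambda>x. deriv_along X f x + lam * divergence X x * f x)"

text \<open>Densities are smooth functions. So that equality of HOL functions is equality of operators
  on smooth functions, all operators are extended by \<open>0\<close> to functions that are not smooth.\<close>

type_synonym 'm operator = "'m scalar_field \<Rightarrow> 'm scalar_field"

definition diffop :: "nat \<Rightarrow> (('m::finite \<Rightarrow> nat) \<Rightarrow> 'm scalar_field) \<Rightarrow> 'm operator"
  where "diffop k a = (\<lambda>f. if smooth f
    then (\<lambda>x. \<Sum>\<alpha> | mdegree \<alpha> \<le> k. a \<alpha> x * mderivative \<alpha> f x) else 0)"

definition diffops_upto :: "nat \<Rightarrow> 'm::finite operator set"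
  where "diffops_upto k = {diffop k a | a. \<forall>\<alpha>. smooth (a \<alpha>)}"

definition diffops :: "'m::finite operator set"
  where "diffops = (\<Union>k. diffops_upto k)"

definition lie_operator :: "real \<Rightarrow> real \<Rightarrow> 'm::finite vector_field \<Rightarrow> 'm operator \<Rightarrow> 'm operator"
  where "lie_operator lam mu X A =
    (\<lambda>f. if smooth f then lie_density mu X (A f) - A (lie_density lam X f) else 0)"


section \<open>Symmetric contravariant tensor fields\<close>

text \<open>The value at \<open>x\<close> of a symmetric contravariant tensor field \<open>P\<close> is the polynomial function
  \<open>P x\<close> in the covector \<open>\<xi>\<close>.\<close>

type_synonym 'm tensor_field = "real ^ 'm \<Rightarrow> real ^ 'm \<Rightarrow> real"

definition poly_field :: "nat \<Rightarrow> (('m::finite \<Rightarrow> nat) \<Rightarrow> 'm scalar_field) \<Rightarrow> 'm tensor_field"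
  where "poly_field k a = (\<lambda>x \<xi>. \<Sum>\<alpha> | mdegree \<alpha> = k. a \<alpha> x * monomial \<alpha> \<xi>)"

definition sym_fields :: "nat \<Rightarrow> 'm::finite tensor_field set"
  where "sym_fields k = {poly_field k a | a. \<forall>\<alpha>. smooth (a \<alpha>)}"

text \<open>The natural representation of \<open>gl(m)\<close> on symmetric tensors: \<open>rho A p\<close> is the derivative at
  \<open>t = 0\<close> of \<open>\<lambda>\<xi>. p (exp (t A\<^sup>T) \<xi>)\<close>, where the transpose appears because \<open>\<xi>\<close> is a covector.
  Its values on products of vectors \<open>v r\<close>, regarded as linear forms in \<open>\<xi>\<close>, are given by
  \<open>rho_prod\<close>.\<close>

definition rho :: "real ^ 'm ^ 'm \<Rightarrow> (real ^ 'm \<Rightarrow> real) \<Rightarrow> real ^ 'm::finite \<Rightarrow> real"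
  where "rho A p = (\<lambda>\<xi>. frechet_derivative p (at \<xi>) (transpose A *v \<xi>))"

lemma rho_prod:
  fixes A :: "real ^ 'm ^ 'm::finite" and v :: "nat \<Rightarrow> real ^ 'm"
  shows "rho A (\<lambda>\<xi>. \<Prod>r<k. v r \<bullet> \<xi>) = (\<lambda>\<xi>. \<Sum>r<k. ((A *v v r) \<bullet> \<xi>) * (\<Prod>s\<in>{..<k} - {r}. v s \<bullet> \<xi>))"
proof
  fix \<xi> :: "real ^ 'm"
  have "((\<lambda>\<xi>. \<Prod>r<k. v r \<bullet> \<xi>) has_derivative
      (\<lambda>h. \<Sum>r<k. (v r \<bullet> h) * (\<Prod>s\<in>{..<k} - {r}. v s \<bullet> \<xi>))) (at \<xi>)"
    by (rule has_derivative_prod) (auto intro!: derivative_eq_intros)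
  from frechet_derivative_at[OF this, symmetric]
  show "rho A (\<lambda>\<xi>. \<Prod>r<k. v r \<bullet> \<xi>) \<xi> = (\<Sum>r<k. ((A *v v r) \<bullet> \<xi>) * (\<Prod>s\<in>{..<k} - {r}. v s \<bullet> \<xi>))"
    by (simp add: rho_def dot_lmul_matrix flip: vector_transpose_matrix)
qed

definition lie_tensor :: "real \<Rightarrow> 'm::finite vector_field \<Rightarrow> 'm tensor_field \<Rightarrow> 'm tensor_field"
  where "lie_tensor \<delta> X P = (\<lambda>x \<xi>.
    deriv_along X (\<lambda>y. P y \<xi>) x - rho (jacobian X (at x)) (P x) \<xi> + \<delta> * divergence X x * P x \<xi>)"

text \<open>Elements of the direct sum of the spaces \<open>sym_fields k\<close> are the finitely supported families.\<close>

type_synonym 'm symbol = "nat \<Rightarrow> 'm tensor_field"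

definition symbols :: "'m::finite symbol set"
  where "symbols = {P. (\<forall>k. P k \<in> sym_fields k) \<and> finite {k. P k \<noteq> 0}}"

definition homogeneous :: "nat \<Rightarrow> 'm::finite tensor_field \<Rightarrow> 'm symbol"
  where "homogeneous k P = (\<lambda>l. if l = k then P else 0)"

definition lie_symbol :: "real \<Rightarrow> 'm::finite vector_field \<Rightarrow> 'm symbol \<Rightarrow> 'm symbol"
  where "lie_symbol \<delta> X P = (\<lambda>k. lie_tensor \<delta> X (P k))"


section \<open>Equivariance\<close>

definition sl_equivariant_op ::
  "real \<Rightarrow> real \<Rightarrow> real \<Rightarrow> real \<Rightarrow> ('m::finite operator \<Rightarrow> 'm operator) \<Rightarrow> bool"
  where "sl_equivariant_op lam mu lam' mu' T \<longleftrightarrow>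
    (\<forall>X\<in>sl_fields. \<forall>A\<in>diffops. T (lie_operator lam mu X A) = lie_operator lam' mu' X (T A))"

text \<open>The characterization of the map \<open>\<sigma>\<^bsup>\<lambda>\<mu>\<^esup>\<close>. The principal symbol of
  \<open>diffop k a\<close>, as an operator of order at most \<open>k\<close>, is \<open>poly_field k a\<close>. Only the values of
  \<open>\<sigma>\<close> on \<open>diffops\<close> are constrained; they are uniquely determined if \<open>(m + 1) \<delta> - m\<close>, where
  \<open>\<delta> = \<mu> - \<lambda>\<close>, is not a positive integer.\<close>

definition sl_symbol_map :: "real \<Rightarrow> real \<Rightarrow> ('m::finite operator \<Rightarrow> 'm symbol) \<Rightarrow> bool"
  where "sl_symbol_map lam mu \<sigma> \<longleftrightarrow>
    linear_map_on diffops \<sigma> \<and>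
    bij_betw \<sigma> diffops symbols \<and>
    (\<forall>X\<in>sl_fields. \<forall>A\<in>diffops. \<sigma> (lie_operator lam mu X A) = lie_symbol (mu - lam) X (\<sigma> A)) \<and>
    (\<forall>k a. (\<forall>\<alpha>. smooth (a \<alpha>)) \<longrightarrow>
      \<sigma> (diffop k a) k = poly_field k a \<and> (\<forall>l>k. \<sigma> (diffop k a) l = 0))"

end

theory Submission
  imports Defs "HOL-Computational_Algebra.Polynomial"
begin

text \<open>Differential operators are stable under the Lie derivative, so conjugating with the symbol maps
  turns \<open>T\<close> into a linear endomorphism of the symbols that commutes with the Lie derivatives; let
  \<open>V\<close> be its component from degree \<open>k\<close> to degree \<open>l\<close>, minus a multiple of the identity if
  \<open>k = l\<close>. Evaluate \<open>V P\<close> at a point \<open>x0\<close> and put \<open>y = x - x0\<close>. The Euler field at \<open>x0\<close> shows that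
  \<open>V ((E h + (l - k) h) \<xi>\<^sup>\<alpha>)\<close> vanishes at \<open>x0\<close>, and every smooth function is a polynomial in \<open>y\<close> plus
  some \<open>E h + (l - k) h\<close>; this replaces continuity or locality. On the tensors \<open>y\<^sup>\<beta> \<xi>\<^sup>\<alpha>\<close>, the
  functional \<open>P \<mapsto> V P x0 e\<^sub>z\<close> is a weight vector for the linear fields, which reduces it to its value on
  \<open>y\<^sub>z\<^sup>k\<^sup>-\<^sup>l \<xi>\<^sub>z\<^sup>k\<close>; for \<open>l < k\<close>, the quadratic field \<open>y\<^sub>z E\<close> multiplies that value by
  \<open>(m + 1) \<delta> - m - (k + l) \<noteq> 0\<close> and shows that the product vanishes.\<close>

section \<open>Calculus of smooth functions\<close>

text \<open>The covector \<open>e_z\<close> is chosen because a linear field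
  \<open>y_j \<partial>_i\<close> vanishing at \<open>x0\<close> moves a covector
  \<open>\<xi>\<close> in the direction \<open>\<xi>_i e_j\<close>: it leaves \<open>e_z\<close>
  alone unless \<open>i = z\<close>. The diagonal fields then force, wherever the value on
  \<open>y^\<beta> \<xi>^\<alpha>\<close> is nonzero, \<open>\<beta>_i = \<alpha>_i\<close> off
  \<open>z\<close> and \<open>\<alpha>_z = \<beta>_z + l\<close>. Summing gives
  \<open>k = |\<beta>| + l\<close>. So raising the degree is impossible by weights alone; lowering
  it is the one case that meets the quadratic fields and the exceptional values of
  \<open>\<delta>\<close>; and for \<open>l = k\<close> only the constant tensor
  \<open>\<xi>_z^k\<close> is left, whose value is the scalar to subtract. Constant fields make that
  scalar independent of \<open>x0\<close>, and the fields \<open>y_j \<partial>_z\<close> carry the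
  vanishing from \<open>e_z\<close> to every covector with \<open>\<xi>_z \<noteq> 0\<close>. The
  converse rests on the fact that Lie derivatives preserve the degree of a symbol.\<close>

lemma smooth_differentiable: "smooth f \<Longrightarrow> f differentiable at x"
  by (auto elim: smooth.cases)

lemma smooth_pderivative: "smooth f \<Longrightarrow> smooth (pderivative i f)"
  by (auto elim: smooth.cases)

lemma pderivativeI: "(f has_derivative f') (at x) \<Longrightarrow> pderivative i f x = f' (axis i 1)"
  using frechet_derivative_at[of f f' x] by (simp add: pderivative_def)

lemma frechet_derivative_pderivative:
  fixes f :: "'m::finite scalar_field"
  assumes "f differentiable at x"
  shows "frechet_derivative f (at x) h = (\<Sum>i\<in>UNIV. h $ i * pderivative i f x)"
proof -
  interpret linear "frechet_derivative f (at x)"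
    by (rule linear_frechet_derivative[OF assms])
  have "h = (\<Sum>i\<in>UNIV. (h $ i) *\<^sub>R axis i 1)"
    using basis_expansion[of h] by (simp add: scalar_mult_eq_scaleR)
  then have "frechet_derivative f (at x) h = frechet_derivative f (at x) (\<Sum>i\<in>UNIV. (h $ i) *\<^sub>R axis i 1)"
    by simp
  also have "\<dots> = (\<Sum>i\<in>UNIV. h $ i * pderivative i f x)"
    by (simp add: sum scaleR pderivative_def)
  finally show ?thesis .
qed

lemma has_derivative_pderivative:
  fixes f :: "'m::finite scalar_field"
  assumes "f differentiable at x"
  shows "(f has_derivative (\<lambda>h. \<Sum>i\<in>UNIV. h $ i * pderivative i f x)) (at x)"
  using assms unfolding frechet_derivative_works
  by (simp add: frechet_derivative_pderivative[OF assms, symmetric])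

lemma smooth_continuous: "smooth f \<Longrightarrow> continuous_on S f"
  by (auto intro!: differentiable_imp_continuous_on differentiable_at_withinI smooth_differentiable
      simp: differentiable_on_def)

lemma pderivative_const: "pderivative i (\<lambda>_. c) = (\<lambda>_. 0)"
  by (simp add: pderivative_def)

lemma pderivative_nth: "pderivative i (\<lambda>x. x $ j) = (\<lambda>_. if i = j then 1 else 0)"
proof
  fix x :: "real ^ 'a"
  have "((\<lambda>x. x $ j) has_derivative (\<lambda>h. h $ j)) (at x)"
    by (intro bounded_linear_imp_has_derivative bounded_linear_vec_nth)
  from pderivativeI[OF this] show "pderivative i (\<lambda>x. x $ j) x = (if i = j then 1 else 0)"
    by (simp add: axis_def)
qed

lemma pderivative_add:
  assumes "f differentiable at x" "g differentiable at x"
  shows "pderivative i (\<lambda>x. f x + g x) x = pderivative i f x + pderivative i g x"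
  using pderivativeI[OF has_derivative_add[OF assms[unfolded frechet_derivative_works]]]
  by (simp add: pderivative_def)

lemma pderivative_mult:
  assumes "f differentiable at x" "g differentiable at x"
  shows "pderivative i (\<lambda>x. f x * g x) x = f x * pderivative i g x + pderivative i f x * g x"
  using pderivativeI[OF has_derivative_mult[OF assms[unfolded frechet_derivative_works]]]
  by (simp add: pderivative_def)

lemma smooth_const: "smooth (\<lambda>_. c)"
proof -
  have "\<exists>c. f = (\<lambda>_. c) \<Longrightarrow> smooth f" for f :: "'a scalar_field"
    by (coinduction arbitrary: f rule: smooth.coinduct) (auto simp: pderivative_const)
  then show ?thesis by blast
qed

lemma smooth_nth: "smooth (\<lambda>x. x $ j)"
  by (rule smooth.intros) (auto simp: pderivative_nth smooth_const
      intro: bounded_linear_imp_differentiable bounded_linear_vec_nth)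

text \<open>Closure under products cannot be proved by coinduction on products alone, since the
  derivative of a product is a sum of products. This class is closed under both operations, hence
  under derivatives, and is a valid coinduction invariant.\<close>

inductive smooth_generated :: "'m::finite scalar_field \<Rightarrow> bool" where
  base: "smooth f \<Longrightarrow> smooth_generated f"
| add: "smooth_generated f \<Longrightarrow> smooth_generated g \<Longrightarrow> smooth_generated (\<lambda>x. f x + g x)"
| mult: "smooth_generated f \<Longrightarrow> smooth_generated g \<Longrightarrow> smooth_generated (\<lambda>x. f x * g x)"

lemma smooth_generated_step:
  "smooth_generated f \<Longrightarrow> (\<forall>x. f differentiable at x) \<and> (\<forall>i. smooth_generated (pderivative i f))"
proof (induction rule: smooth_generated.induct)
  case (base f)
  then show ?case by (auto intro: smooth_differentiable smooth_generated.base smooth_pderivative)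
next
  case (add f g)
  then have "pderivative i (\<lambda>x. f x + g x) = (\<lambda>x. pderivative i f x + pderivative i g x)" for i
    by (auto simp: pderivative_add)
  with add show ?case by (auto intro!: smooth_generated.add)
next
  case (mult f g)
  then have "pderivative i (\<lambda>x. f x * g x) = (\<lambda>x. f x * pderivative i g x + pderivative i f x * g x)" for i
    by (auto simp: pderivative_mult)
  with mult show ?case by (auto intro!: smooth_generated.add smooth_generated.mult)
qed

lemma smooth_generated_smooth: "smooth_generated f \<Longrightarrow> smooth f"
  by (coinduction arbitrary: f rule: smooth.coinduct) (auto dest: smooth_generated_step)

lemma smooth_add: "smooth f \<Longrightarrow> smooth g \<Longrightarrow> smooth (\<lambda>x. f x + g x)"
  by (rule smooth_generated_smooth, rule smooth_generated.add; erule smooth_generated.base)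

lemma smooth_mult: "smooth f \<Longrightarrow> smooth g \<Longrightarrow> smooth (\<lambda>x. f x * g x)"
  by (rule smooth_generated_smooth, rule smooth_generated.mult; erule smooth_generated.base)

lemma smooth_diff: "smooth f \<Longrightarrow> smooth g \<Longrightarrow> smooth (\<lambda>x. f x - g x)"
  using smooth_add[of f "\<lambda>x. - 1 * g x"] smooth_mult[OF smooth_const[of "-1"], of g] by simp

lemma smooth_sum: "(\<And>a. a \<in> S \<Longrightarrow> smooth (f a)) \<Longrightarrow> smooth (\<lambda>x. \<Sum>a\<in>S. f a x)"
  by (induction S rule: infinite_finite_induct) (auto intro: smooth_const smooth_add)

lemma smooth_prod: "(\<And>a. a \<in> S \<Longrightarrow> smooth (f a)) \<Longrightarrow> smooth (\<lambda>x. \<Prod>a\<in>S. f a x)"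
  by (induction S rule: infinite_finite_induct) (auto intro: smooth_const smooth_mult)

lemma smooth_power: "smooth f \<Longrightarrow> smooth (\<lambda>x. f x ^ n)"
  by (induction n) (auto intro: smooth_const smooth_mult)

lemmas smooth_intros = smooth_const smooth_nth smooth_add smooth_diff smooth_mult smooth_sum
  smooth_prod smooth_power smooth_pderivative

lemma smooth_monomial: "smooth (\<lambda>x. monomial \<alpha> (x - x0))"
  unfolding monomial_def vector_minus_component by (intro smooth_intros)

lemma pderivative_sum:
  assumes "\<And>a. a \<in> S \<Longrightarrow> f a differentiable at x"
  shows "pderivative i (\<lambda>x. \<Sum>a\<in>S. f a x) x = (\<Sum>a\<in>S. pderivative i (f a) x)"
proof -
  have "((\<lambda>x. \<Sum>a\<in>S. f a x) has_derivative (\<lambda>h. \<Sum>a\<in>S. frechet_derivative (f a) (at x) h)) (at x)"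
    using assms by (intro has_derivative_sum) (simp add: frechet_derivative_works)
  from pderivativeI[OF this] show ?thesis by (simp add: pderivative_def)
qed

section \<open>Integrals along rays, the Euler identity and Hadamard's lemma\<close>

definition ray_integral :: "real ^ 'm::finite \<Rightarrow> (real \<Rightarrow> real) \<Rightarrow> 'm scalar_field \<Rightarrow> 'm scalar_field"
  where "ray_integral x0 w f = (\<lambda>x. integral {0..1} (\<lambda>t. w t * f (x0 + t *\<^sub>R (x - x0))))"

lemma smooth_ray_continuous:
  assumes "smooth f"
  shows "continuous_on S (\<lambda>t. f (x0 + t *\<^sub>R (x - x0)))"
  by (rule continuous_on_compose2[OF smooth_continuous[OF assms, of UNIV]])
    (auto intro!: continuous_intros)

lemma ray_integral_has_derivative:
  fixes f :: "'m::finite scalar_field"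
  assumes f: "smooth f" and w: "continuous_on {0..1} w"
  shows "(ray_integral x0 w f has_derivative
    (\<lambda>h. \<Sum>i\<in>UNIV. h $ i * ray_integral x0 (\<lambda>t. t * w t) (pderivative i f) x)) (at x)"
proof -
  \<comment> \<open>\<open>leibniz_rule\<close> wants the derivative of the integrand as a bounded
    operator, jointly continuous in the operator norm. Since \<open>D\<close> is assembled from
    coordinate projections and scalar coefficients, continuity of the coefficients is
    enough.\<close>
  define D where "D = (\<lambda>x t. blinfun_scaleR_left (w t * t) o\<^sub>L
      (\<Sum>i\<in>UNIV. blinfun_mult_right (pderivative i f (x0 + t *\<^sub>R (x - x0))) o\<^sub>L Blinfun (\<lambda>h. h $ i)))"
  have bl: "bounded_linear (\<lambda>h::real^'m. h $ i)" for i
    by (rule bounded_linear_vec_nth)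
  have D_apply: "blinfun_apply (D x t) h =
      (\<Sum>i\<in>UNIV. h $ i * (t * w t * pderivative i f (x0 + t *\<^sub>R (x - x0))))" for x t h
    by (simp add: D_def blinfun.sum_left bounded_linear_Blinfun_apply[OF bl] sum_distrib_left
        mult_ac sum_distrib_right)
  have cp: "continuous_on S (\<lambda>z. pderivative i f (x0 + snd z *\<^sub>R (fst z - x0)))" for S i
    by (rule continuous_on_compose2[OF smooth_continuous[OF smooth_pderivative[OF f], of UNIV]])
      (auto intro!: continuous_intros)
  have cw: "continuous_on (UNIV \<times> {0..1}) (\<lambda>z. w (snd z))"
    by (rule continuous_on_compose2[OF w]) (auto intro!: continuous_intros)
  have "((\<lambda>x. integral (cbox 0 1) (\<lambda>t. w t * f (x0 + t *\<^sub>R (x - x0)))) has_derivative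
      blinfun_apply (integral (cbox 0 1) (D x))) (at x within UNIV)"
  proof (rule leibniz_rule)
    show "((\<lambda>x. w t * f (x0 + t *\<^sub>R (x - x0))) has_derivative blinfun_apply (D x t)) (at x within UNIV)" for x t
    proof -
      have "(f has_derivative (\<lambda>h. \<Sum>i\<in>UNIV. h $ i * pderivative i f (x0 + t *\<^sub>R (x - x0))))
          (at (x0 + t *\<^sub>R (x - x0)))"
        by (intro has_derivative_pderivative smooth_differentiable f)
      moreover have "((\<lambda>x. x0 + t *\<^sub>R (x - x0)) has_derivative (\<lambda>h. t *\<^sub>R h)) (at x)"
        by (auto intro!: derivative_eq_intros)
      ultimately have "((\<lambda>x. f (x0 + t *\<^sub>R (x - x0))) has_derivative
          (\<lambda>h. \<Sum>i\<in>UNIV. (t *\<^sub>R h) $ i * pderivative i f (x0 + t *\<^sub>R (x - x0)))) (at x)"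
        by (rule has_derivative_compose[rotated])
      then have "((\<lambda>x. w t * f (x0 + t *\<^sub>R (x - x0))) has_derivative
          (\<lambda>h. w t * (\<Sum>i\<in>UNIV. (t *\<^sub>R h) $ i * pderivative i f (x0 + t *\<^sub>R (x - x0))))) (at x)"
        by (rule has_derivative_mult_right)
      then show ?thesis
        by (rule has_derivative_eq_rhs) (auto simp: D_apply sum_distrib_left mult_ac)
    qed
    show "(\<lambda>t. w t * f (x0 + t *\<^sub>R (x - x0))) integrable_on cbox 0 1" for x
      using w by (auto intro!: integrable_continuous_interval continuous_intros smooth_ray_continuous f)
    show "continuous_on (UNIV \<times> cbox 0 1) (\<lambda>(x, t). D x t)"
      unfolding D_def split_beta
      using cw by (auto intro!: continuous_intros cp)
  qed auto
  then have "(ray_integral x0 w f has_derivative blinfun_apply (integral (cbox 0 1) (D x))) (at x)"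
    by (simp add: ray_integral_def[abs_def])
  moreover have "blinfun_apply (integral (cbox 0 1) (D x)) h =
      (\<Sum>i\<in>UNIV. h $ i * ray_integral x0 (\<lambda>t. t * w t) (pderivative i f) x)" for h
  proof -
    have "D x integrable_on cbox 0 1"
      unfolding D_def using w
      by (auto intro!: integrable_continuous_interval continuous_intros smooth_ray_continuous smooth_pderivative f)
    then have "blinfun_apply (integral (cbox 0 1) (D x)) h = integral (cbox 0 1) (\<lambda>t. blinfun_apply (D x t) h)"
      by (rule blinfun_apply_integral)
    also have "\<dots> = (\<Sum>i\<in>UNIV. integral {0..1} (\<lambda>t. h $ i * (t * w t * pderivative i f (x0 + t *\<^sub>R (x - x0)))))"
      unfolding D_apply cbox_interval using w
      by (subst integral_sum)
        (auto intro!: integrable_continuous_interval continuous_intros smooth_ray_continuous smooth_pderivative f)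
    finally show ?thesis by (simp add: ray_integral_def)
  qed
  ultimately show ?thesis by (auto elim!: has_derivative_eq_rhs)
qed

lemma pderivative_ray_integral:
  assumes "smooth f" "continuous_on {0..1} w"
  shows "pderivative i (ray_integral x0 w f) = ray_integral x0 (\<lambda>t. t * w t) (pderivative i f)"
  using pderivativeI[OF ray_integral_has_derivative[OF assms]]
  by (auto simp: fun_eq_iff axis_def if_distrib[of "\<lambda>x. x * _"] cong: if_cong)

text \<open>Differentiation replaces the weight \<open>w t\<close> by \<open>t * w t\<close>, so the
  coinduction must run over all continuous weights at once.\<close>

lemma smooth_ray_integral:
  assumes "smooth f" "continuous_on {0..1} w"
  shows "smooth (ray_integral x0 w f)"
proof -
  have "\<exists>w f. smooth f \<and> continuous_on {0..1} w \<and> g = ray_integral x0 w f \<Longrightarrow> smooth g" for g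
  proof (coinduction arbitrary: g rule: smooth.coinduct)
    case (smooth g)
    then obtain w f where wf: "smooth f" "continuous_on {0..1} w" "g = ray_integral x0 w f" by blast
    have "g differentiable at x" for x
      using ray_integral_has_derivative[OF wf(1,2)] wf(3) by (auto simp: differentiable_def)
    moreover have "continuous_on {0..1} (\<lambda>t. t * w t)"
      using wf(2) by (intro continuous_intros)
    ultimately show ?case
      using wf pderivative_ray_integral[OF wf(1,2)] smooth_pderivative[OF wf(1)] by blast
  qed
  then show ?thesis using assms by blast
qed

definition euler :: "real ^ 'm::finite \<Rightarrow> 'm scalar_field \<Rightarrow> 'm scalar_field"
  where "euler x0 f = (\<lambda>x. \<Sum>i\<in>UNIV. (x - x0) $ i * pderivative i f x)"

lemma ray_has_derivative:
  assumes f: "smooth f"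
  shows "((\<lambda>t. f (x0 + t *\<^sub>R (x - x0))) has_real_derivative
      (\<Sum>i\<in>UNIV. (x - x0) $ i * pderivative i f (x0 + t *\<^sub>R (x - x0)))) (at t)"
proof -
  have "((\<lambda>t. x0 + t *\<^sub>R (x - x0)) has_derivative (\<lambda>s. s *\<^sub>R (x - x0))) (at t)"
    by (auto intro!: derivative_eq_intros)
  from has_derivative_compose[OF this has_derivative_pderivative[OF smooth_differentiable[OF f]]]
  show ?thesis
    unfolding has_field_derivative_def
    by (rule has_derivative_eq_rhs) (auto simp: sum_distrib_left mult_ac)
qed

text \<open>On a ray, \<open>t d/dt\<close> acts as the Euler operator. Integrating the derivative
  of \<open>t^(n+1) f(x0 + t y)\<close> over \<open>[0,1]\<close> therefore shows that the weight
  \<open>t^n\<close> gives a right inverse of \<open>E + (n + 1)\<close>.\<close>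

lemma euler_ray_integral:
  fixes f :: "'m::finite scalar_field"
  assumes f: "smooth f"
  shows "euler x0 (ray_integral x0 (\<lambda>t. t ^ n) f) x + (real n + 1) * ray_integral x0 (\<lambda>t. t ^ n) f x = f x"
proof -
  let ?r = "\<lambda>t. x0 + t *\<^sub>R (x - x0)"
  let ?d = "\<lambda>t. \<Sum>i\<in>UNIV. (x - x0) $ i * pderivative i f (?r t)"
  have c: "continuous_on {0..1} (\<lambda>t::real. t ^ n)" by (intro continuous_intros)
  have "((\<lambda>t. t ^ Suc n * ?d t + real (Suc n) * t ^ n * f (?r t)) has_integral
      (1 ^ Suc n * f (?r 1) - 0 ^ Suc n * f (?r 0))) {0..1}"
  proof (rule fundamental_theorem_of_calculus)
    fix t :: real
    have "((\<lambda>t. t ^ Suc n * f (?r t)) has_real_derivative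
        t ^ Suc n * ?d t + real (Suc n) * t ^ n * f (?r t)) (at t)"
      by (rule derivative_eq_intros ray_has_derivative[OF f] refl)+ simp
    then show "((\<lambda>t. t ^ Suc n * f (?r t)) has_vector_derivative
        t ^ Suc n * ?d t + real (Suc n) * t ^ n * f (?r t)) (at t within {0..1})"
      by (auto simp: has_real_derivative_iff_has_vector_derivative intro: has_vector_derivative_at_within)
  qed auto
  then have "f x = integral {0..1} (\<lambda>t. t ^ Suc n * ?d t + real (Suc n) * t ^ n * f (?r t))"
    by (simp add: integral_unique)
  also have "\<dots> = integral {0..1} (\<lambda>t. t ^ Suc n * ?d t) + integral {0..1} (\<lambda>t. real (Suc n) * (t ^ n * f (?r t)))"
    by (subst integral_add[symmetric])
      (auto intro!: integrable_continuous_interval continuous_intros smooth_ray_continuous smooth_intros f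
        simp: mult.assoc)
  also have "integral {0..1} (\<lambda>t. t ^ Suc n * ?d t) =
      integral {0..1} (\<lambda>t. \<Sum>i\<in>UNIV. (x - x0) $ i * (t * t ^ n * pderivative i f (?r t)))"
    by (simp add: sum_distrib_left mult_ac)
  also have "\<dots> = (\<Sum>i\<in>UNIV. (x - x0) $ i * ray_integral x0 (\<lambda>t. t * t ^ n) (pderivative i f) x)"
    unfolding ray_integral_def
    by (subst integral_sum)
      (auto intro!: integrable_continuous_interval continuous_intros smooth_ray_continuous smooth_intros f)
  also have "\<dots> = euler x0 (ray_integral x0 (\<lambda>t. t ^ n) f) x"
    by (simp add: euler_def pderivative_ray_integral[OF f c])
  finally show ?thesis by (simp add: ray_integral_def)
qed

text \<open>The coefficients of \<open>(x - x0) $ i\<close> are again smooth, so the expansion can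
  be iterated.\<close>

lemma hadamard:
  fixes f :: "'m::finite scalar_field"
  assumes f: "smooth f"
  shows "f x = f x0 + (\<Sum>i\<in>UNIV. (x - x0) $ i * ray_integral x0 (\<lambda>_. 1) (pderivative i f) x)"
proof -
  let ?r = "\<lambda>t. x0 + t *\<^sub>R (x - x0)"
  have "((\<lambda>t. \<Sum>i\<in>UNIV. (x - x0) $ i * pderivative i f (?r t)) has_integral f (?r 1) - f (?r 0)) {0..1}"
    by (rule fundamental_theorem_of_calculus)
      (use ray_has_derivative[OF f] in \<open>auto simp: has_real_derivative_iff_has_vector_derivative
        intro: has_vector_derivative_at_within\<close>)
  then have "f x - f x0 = integral {0..1} (\<lambda>t. \<Sum>i\<in>UNIV. (x - x0) $ i * pderivative i f (?r t))"
    by (simp add: integral_unique)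
  also have "\<dots> = (\<Sum>i\<in>UNIV. (x - x0) $ i * ray_integral x0 (\<lambda>_. 1) (pderivative i f) x)"
    unfolding ray_integral_def
    by (subst integral_sum)
      (auto intro!: integrable_continuous_interval continuous_intros smooth_ray_continuous smooth_intros f)
  finally show ?thesis by simp
qed

section \<open>Closure of differential operators under Lie derivatives\<close>

text \<open>Hadamard's formula differentiated in direction \<open>j\<close>, and the Euler identity
  with \<open>n = 0\<close> for \<open>\<partial>_j f\<close>, express the same function; they
  differ only in the order of two derivatives under \<open>R\<close>. Their difference
  \<open>F\<close> is therefore 0. Its derivative \<open>\<partial>_i F\<close> at \<open>x0\<close>
  is half the commutator, the half being the integral of the weight \<open>t\<close> of
  \<open>R\<close>.\<close>

lemma pderivative_commute:
  fixes f :: "'m::finite scalar_field"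
  assumes f: "smooth f"
  shows "pderivative i (pderivative j f) = pderivative j (pderivative i f)"
proof
  fix x0 :: "real ^ 'm"
  define R where "R = (\<lambda>g. ray_integral x0 (\<lambda>t. t * 1) g)"
  have smR: "smooth (R g)" if "smooth g" for g
    unfolding R_def by (intro smooth_ray_integral that continuous_intros)
  have sm1: "smooth (ray_integral x0 (\<lambda>t. 1) g)" if "smooth g" for g
    by (intro smooth_ray_integral that continuous_intros)
  have pd: "pderivative i (ray_integral x0 (\<lambda>t. 1) g) = R (pderivative i g)" if "smooth g" for g i
    unfolding R_def by (intro pderivative_ray_integral that continuous_intros)
  have smy: "smooth (\<lambda>x. (x - x0) $ k)" for k
    unfolding vector_minus_component by (intro smooth_intros)
  note sm = smooth_intros smR sm1 f smy
  have pdy: "pderivative j (\<lambda>x. (x - x0) $ k) x = (if j = k then 1 else 0)" for k x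
    unfolding vector_minus_component
    using pderivative_add[of "\<lambda>x. x $ k" x "\<lambda>_. - (x0 $ k)" j]
    by (simp add: pderivative_nth pderivative_const smooth_differentiable smooth_nth)
  define F where "F = (\<lambda>x. \<Sum>k\<in>UNIV. (x - x0) $ k *
      (R (pderivative j (pderivative k f)) x - R (pderivative k (pderivative j f)) x))"
  have "F x = 0" for x
  proof -
    have "f = (\<lambda>x. f x0 + (\<Sum>k\<in>UNIV. (x - x0) $ k * ray_integral x0 (\<lambda>_. 1) (pderivative k f) x))"
      by (rule ext) (rule hadamard[OF f])
    then have "pderivative j f x =
        pderivative j (\<lambda>x. f x0 + (\<Sum>k\<in>UNIV. (x - x0) $ k * ray_integral x0 (\<lambda>_. 1) (pderivative k f) x)) x"
      by simp
    also have "\<dots> = (\<Sum>k\<in>UNIV. (x - x0) $ k * R (pderivative j (pderivative k f)) x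
        + (if j = k then 1 else 0) * ray_integral x0 (\<lambda>_. 1) (pderivative k f) x)"
      by (simp add: pderivative_add pderivative_sum pderivative_mult pderivative_const
          smooth_differentiable sm pdy pd del: vector_minus_component)
    also have "\<dots> = (\<Sum>k\<in>UNIV. (x - x0) $ k * R (pderivative j (pderivative k f)) x)
        + ray_integral x0 (\<lambda>_. 1) (pderivative j f) x"
      by (simp add: sum.distrib if_distrib[of "\<lambda>c. c * _"] cong: if_cong)
    finally have "pderivative j f x = \<dots>" .
    moreover have "(\<Sum>k\<in>UNIV. (x - x0) $ k * R (pderivative k (pderivative j f)) x)
        + ray_integral x0 (\<lambda>_. 1) (pderivative j f) x = pderivative j f x"
      using euler_ray_integral[of "pderivative j f" x0 0 x]
      by (simp add: euler_def pd smooth_pderivative f)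
    ultimately show ?thesis
      by (simp add: F_def right_diff_distrib sum_subtractf)
  qed
  then have "F = (\<lambda>_. 0)" by (rule ext)
  then have "pderivative i F x0 = 0" by (simp add: pderivative_const)
  moreover have "pderivative i F x0 =
      R (pderivative j (pderivative i f)) x0 - R (pderivative i (pderivative j f)) x0"
  proof -
    have pdy': "pderivative i (\<lambda>x. (x - x0) $ k) x = (if i = k then 1 else 0)" for k x
      unfolding vector_minus_component
      using pderivative_add[of "\<lambda>x. x $ k" x "\<lambda>_. - (x0 $ k)" i]
      by (simp add: pderivative_nth pderivative_const smooth_differentiable smooth_nth)
    have "pderivative i F x0 = (\<Sum>k\<in>UNIV. (if i = k then 1 else 0) *
        (R (pderivative j (pderivative k f)) x0 - R (pderivative k (pderivative j f)) x0))"
      unfolding F_def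
      by (simp add: pderivative_sum pderivative_mult smooth_differentiable sm pdy' del: vector_minus_component)
    then show ?thesis by (simp add: if_distrib[of "\<lambda>c. c * _"] cong: if_cong)
  qed
  moreover have "R g x0 = g x0 / 2" for g
  proof -
    have "((\<lambda>t. t * g x0) has_integral ((1\<^sup>2 - 0\<^sup>2) / 2) * g x0) {0..1::real}"
      by (intro has_integral_mult_left ident_has_integral) simp
    then show ?thesis by (simp add: R_def ray_integral_def integral_unique)
  qed
  ultimately show "pderivative i (pderivative j f) x0 = pderivative j (pderivative i f) x0"
    by simp
qed

section \<open>Iterated partial derivatives in the fixed order of the indices\<close>

lemma smooth_funpow_pderivative: "smooth f \<Longrightarrow> smooth ((pderivative i ^^ n) f)"
  by (induction n) (auto intro: smooth_pderivative)

lemma funpow_pderivative_commute: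
  "smooth f \<Longrightarrow> (pderivative j ^^ n) (pderivative i f) = pderivative i ((pderivative j ^^ n) f)"
  by (induction n) (simp_all add: pderivative_commute[OF smooth_funpow_pderivative, of f i j])

lemma smooth_foldr_pderivative: "smooth f \<Longrightarrow> smooth (foldr (\<lambda>i. pderivative i ^^ \<alpha> i) is f)"
  by (induction "is") (auto intro: smooth_funpow_pderivative)

lemma smooth_mderivative: "smooth f \<Longrightarrow> smooth (mderivative \<alpha> f)"
  unfolding mderivative_def by (rule smooth_foldr_pderivative)

text \<open>Distinctness makes \<open>i\<close> occur once in the list; the additional derivative is
  commuted outwards past the derivatives in the indices that precede it.\<close>

lemma foldr_pderivative_upd:
  assumes "smooth f" "distinct is" "i \<in> set is"
  shows "foldr (\<lambda>j. pderivative j ^^ (\<alpha>(i := Suc (\<alpha> i))) j) is f =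
    pderivative i (foldr (\<lambda>j. pderivative j ^^ \<alpha> j) is f)"
  using assms(2,3)
proof (induction "is")
  case (Cons j js)
  show ?case
  proof (cases "j = i")
    case True
    then have "foldr (\<lambda>j. pderivative j ^^ (\<alpha>(i := Suc (\<alpha> i))) j) js f = foldr (\<lambda>j. pderivative j ^^ \<alpha> j) js f"
      using Cons.prems by (intro foldr_cong) auto
    with True show ?thesis by simp
  next
    case False
    with Cons show ?thesis
      by (simp add: funpow_pderivative_commute smooth_foldr_pderivative assms(1))
  qed
qed simp

lemma pderivative_mderivative:
  "smooth f \<Longrightarrow> pderivative i (mderivative \<alpha> f) = mderivative (\<alpha>(i := Suc (\<alpha> i))) f"
  unfolding mderivative_def by (simp only: foldr_pderivative_upd index_list UNIV_I)

text \<open>Membership in \<open>diffops\<close> without the convention about functions that are not smooth.\<close>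

definition differential :: "'m::finite operator \<Rightarrow> bool"
  where "differential A \<longleftrightarrow> (\<exists>k a. (\<forall>\<alpha>. smooth (a \<alpha>)) \<and>
    (\<forall>f. smooth f \<longrightarrow> A f = (\<lambda>x. \<Sum>\<alpha> | mdegree \<alpha> \<le> k. a \<alpha> x * mderivative \<alpha> f x)))"

lemma diffops_iff: "A \<in> diffops \<longleftrightarrow> differential A \<and> (\<forall>f. \<not> smooth f \<longrightarrow> A f = 0)"
proof
  assume "A \<in> diffops"
  then show "differential A \<and> (\<forall>f. \<not> smooth f \<longrightarrow> A f = 0)"
    unfolding diffops_def diffops_upto_def differential_def
    by (auto simp: diffop_def) blast
next
  assume r: "differential A \<and> (\<forall>f. \<not> smooth f \<longrightarrow> A f = 0)"
  then obtain k a where "\<forall>\<alpha>. smooth (a \<alpha>)"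
    "\<forall>f. smooth f \<longrightarrow> A f = (\<lambda>x. \<Sum>\<alpha> | mdegree \<alpha> \<le> k. a \<alpha> x * mderivative \<alpha> f x)"
    unfolding differential_def by blast
  moreover from this r have "A = diffop k a"
    by (auto simp: diffop_def fun_eq_iff)
  ultimately have "A \<in> diffops_upto k"
    unfolding diffops_upto_def mem_Collect_eq by (intro exI[of _ a]) simp
  then show "A \<in> diffops" by (auto simp: diffops_def)
qed

lemma differential_cong:
  "differential A \<Longrightarrow> (\<And>f. smooth f \<Longrightarrow> A f = B f) \<Longrightarrow> differential B"
  unfolding differential_def by simp

lemma differentialE:
  assumes "differential A"
  obtains k a where "\<And>\<alpha>. smooth (a \<alpha>)"
    "\<And>f. smooth f \<Longrightarrow> A f = (\<lambda>x. \<Sum>\<alpha> | mdegree \<alpha> \<le> k. a \<alpha> x * mderivative \<alpha> f x)"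
proof -
  from assms obtain k a where "\<forall>\<alpha>. smooth (a \<alpha>)"
    "\<forall>f. smooth f \<longrightarrow> A f = (\<lambda>x. \<Sum>\<alpha> | mdegree \<alpha> \<le> k. a \<alpha> x * mderivative \<alpha> f x)"
    unfolding differential_def by (elim exE conjE)
  then show thesis by (intro that[of a k]) simp_all
qed

lemma differential_zero: "differential (\<lambda>f x. 0)"
  unfolding differential_def by (rule exI[of _ 0], rule exI[of _ "\<lambda>_ _. 0"]) (simp add: smooth_const)

lemma differential_mderivative:
  assumes "smooth c"
  shows "differential (\<lambda>f x. c x * mderivative \<alpha> f x)"
  unfolding differential_def
proof (intro exI[of _ "mdegree \<alpha>"] exI[of _ "\<lambda>\<beta>. if \<beta> = \<alpha> then c else (\<lambda>_. 0)"] conjI allI impI)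
  show "smooth (if \<beta> = \<alpha> then c else (\<lambda>_. 0))" for \<beta>
    using assms by (auto intro: smooth_const)
  show "(\<lambda>x. c x * mderivative \<alpha> f x) = (\<lambda>x. \<Sum>\<beta> | mdegree \<beta> \<le> mdegree \<alpha>.
      (if \<beta> = \<alpha> then c else (\<lambda>_. 0)) x * mderivative \<beta> f x)" for f
  proof
    fix x
    have "(\<Sum>\<beta> | mdegree \<beta> \<le> mdegree \<alpha>. (if \<beta> = \<alpha> then c else (\<lambda>_. 0)) x * mderivative \<beta> f x) =
        (\<Sum>\<beta> | mdegree \<beta> \<le> mdegree \<alpha>. if \<beta> = \<alpha> then c x * mderivative \<beta> f x else 0)"
      by (rule sum.cong) auto
    then show "c x * mderivative \<alpha> f x = (\<Sum>\<beta> | mdegree \<beta> \<le> mdegree \<alpha>.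
        (if \<beta> = \<alpha> then c else (\<lambda>_. 0)) x * mderivative \<beta> f x)"
      by (simp add: finite_mdegree_le)
  qed
qed

lemma differential_add:
  assumes "differential A" "differential B"
  shows "differential (\<lambda>f x. A f x + B f x)"
proof -
  obtain k a where a: "\<And>\<alpha>. smooth (a \<alpha>)"
    "\<And>f. smooth f \<Longrightarrow> A f = (\<lambda>x. \<Sum>\<alpha> | mdegree \<alpha> \<le> k. a \<alpha> x * mderivative \<alpha> f x)"
    by (rule differentialE[OF assms(1)]) (rule that)
  obtain l b where b: "\<And>\<alpha>. smooth (b \<alpha>)"
    "\<And>f. smooth f \<Longrightarrow> B f = (\<lambda>x. \<Sum>\<alpha> | mdegree \<alpha> \<le> l. b \<alpha> x * mderivative \<alpha> f x)"
    by (rule differentialE[OF assms(2)]) (rule that)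
  \<comment> \<open>The coefficients of \<open>A\<close> beyond order \<open>k\<close> are
    arbitrary, and so are those of \<open>B\<close> beyond \<open>l\<close>. They are cut off before
    both sums are extended to order \<open>max k l\<close>.\<close>
  define c where "c = (\<lambda>\<alpha> x. (if mdegree \<alpha> \<le> k then a \<alpha> x else 0) + (if mdegree \<alpha> \<le> l then b \<alpha> x else 0))"
  have ext: "(\<Sum>\<alpha> | mdegree \<alpha> \<le> k. a \<alpha> x * g \<alpha>) =
      (\<Sum>\<alpha> | mdegree \<alpha> \<le> max k l. (if mdegree \<alpha> \<le> k then a \<alpha> x else 0) * g \<alpha>)"
    for k l :: nat and a and g :: "('a \<Rightarrow> nat) \<Rightarrow> real" and x :: "real ^ 'a"
    by (rule sum.mono_neutral_cong_left) (auto simp: finite_mdegree_le)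
  have "smooth (c \<alpha>)" for \<alpha>
    unfolding c_def
    by (cases "mdegree \<alpha> \<le> k"; cases "mdegree \<alpha> \<le> l") (simp_all add: smooth_intros a b)
  moreover have "(\<lambda>x. A f x + B f x) = (\<lambda>x. \<Sum>\<alpha> | mdegree \<alpha> \<le> max k l. c \<alpha> x * mderivative \<alpha> f x)"
    if "smooth f" for f
    using ext[where k = k and l = l and a = a] ext[where k = l and l = k and a = b]
    by (simp add: a(2) b(2) that c_def distrib_right sum.distrib max.commute)
  ultimately show ?thesis
    unfolding differential_def by (intro exI[of _ "max k l"] exI[of _ c]) simp
qed

lemma differential_sum: "(\<And>a. a \<in> S \<Longrightarrow> differential (A a)) \<Longrightarrow> differential (\<lambda>f x. \<Sum>a\<in>S. A a f x)"
  by (induction S rule: infinite_finite_induct) (auto intro: differential_zero differential_add)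

lemma differential_mult:
  assumes "smooth c" "differential A"
  shows "differential (\<lambda>f x. c x * A f x)"
proof -
  obtain k a where a: "\<And>\<alpha>. smooth (a \<alpha>)"
    "\<And>f. smooth f \<Longrightarrow> A f = (\<lambda>x. \<Sum>\<alpha> | mdegree \<alpha> \<le> k. a \<alpha> x * mderivative \<alpha> f x)"
    by (rule differentialE[OF assms(2)]) (rule that)
  have "differential (\<lambda>f x. \<Sum>\<alpha> | mdegree \<alpha> \<le> k. (c x * a \<alpha> x) * mderivative \<alpha> f x)"
    by (intro differential_sum differential_mderivative smooth_intros assms a)
  then show ?thesis
    by (rule differential_cong) (simp add: a(2) sum_distrib_left mult.assoc)
qed

lemma differential_id: "differential (\<lambda>f :: 'm::finite scalar_field. f)"
proof -
  have "foldr (\<lambda>_. id) is = (\<lambda>f :: 'm scalar_field. f)" for "is" :: "'m list"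
    by (induction "is") (auto simp: fun_eq_iff)
  then show ?thesis
    using differential_mderivative[OF smooth_const[of 1], of "\<lambda>_ :: 'm. 0"] by (simp add: mderivative_def)
qed

lemma smooth_differential: "differential A \<Longrightarrow> smooth f \<Longrightarrow> smooth (A f)"
  unfolding differential_def by (auto intro!: smooth_intros smooth_mderivative)

lemma differential_pderivative:
  assumes "differential A"
  shows "differential (\<lambda>f. pderivative i (A f))"
proof -
  obtain k a where a: "\<And>\<alpha>. smooth (a \<alpha>)"
    "\<And>f. smooth f \<Longrightarrow> A f = (\<lambda>x. \<Sum>\<alpha> | mdegree \<alpha> \<le> k. a \<alpha> x * mderivative \<alpha> f x)"
    by (rule differentialE[OF assms]) (rule that)
  have "differential (\<lambda>f x. \<Sum>\<alpha> | mdegree \<alpha> \<le> k.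
      a \<alpha> x * mderivative (\<alpha>(i := Suc (\<alpha> i))) f x + pderivative i (a \<alpha>) x * mderivative \<alpha> f x)"
    by (intro differential_sum differential_add differential_mderivative smooth_intros a)
  then show ?thesis
    by (rule differential_cong)
      (simp add: a fun_eq_iff pderivative_sum pderivative_mult smooth_differentiable smooth_intros
        smooth_mderivative pderivative_mderivative)
qed

lemma differential_foldr_pderivative:
  assumes "differential L"
  shows "differential (\<lambda>f. foldr (\<lambda>i. pderivative i ^^ \<alpha> i) is (L f))"
proof (induction "is")
  case (Cons i js)
  have "differential (\<lambda>f. (pderivative i ^^ n) (foldr (\<lambda>i. pderivative i ^^ \<alpha> i) js (L f)))" for n
    by (induction n) (auto intro: Cons differential_pderivative)
  then show ?case by simp
qed (use assms in simp)

text \<open>No multi-index Leibniz rule is involved: \<open>\<partial>^\<alpha> (L f)\<close> arises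
  from \<open>L f\<close> by one partial derivative at a time, and each of these preserves
  \<open>differential\<close>.\<close>

lemma differential_comp:
  assumes "differential A" "differential L"
  shows "differential (\<lambda>f. A (L f))"
proof -
  obtain k a where a: "\<And>\<alpha>. smooth (a \<alpha>)"
    "\<And>f. smooth f \<Longrightarrow> A f = (\<lambda>x. \<Sum>\<alpha> | mdegree \<alpha> \<le> k. a \<alpha> x * mderivative \<alpha> f x)"
    by (rule differentialE[OF assms(1)]) (rule that)
  have "differential (\<lambda>f x. \<Sum>\<alpha> | mdegree \<alpha> \<le> k. a \<alpha> x * mderivative \<alpha> (L f) x)"
    unfolding mderivative_def
    by (intro differential_sum differential_mult a differential_foldr_pderivative assms)
  then show ?thesis
    by (rule differential_cong) (simp add: a(2) smooth_differential[OF assms(2)])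
qed

section \<open>Lie derivatives along smooth vector fields\<close>

definition smooth_field :: "'m::finite vector_field \<Rightarrow> bool"
  where "smooth_field X \<longleftrightarrow> (\<forall>x. X differentiable at x) \<and> (\<forall>i. smooth (\<lambda>x. X x $ i))"

lemma divergence_eq:
  assumes "X differentiable at x"
  shows "divergence X x = (\<Sum>i\<in>UNIV. pderivative i (\<lambda>x. X x $ i) x)"
proof -
  have "((\<lambda>x. X x $ i) has_derivative (\<lambda>h. frechet_derivative X (at x) h $ i)) (at x)" for i
    using assms unfolding frechet_derivative_works
    by (rule bounded_linear.has_derivative[OF bounded_linear_vec_nth])
  from pderivativeI[OF this] show ?thesis
    by (simp add: trace_def jacobian_def matrix_def)
qed

lemma smooth_divergence:
  assumes "smooth_field X"
  shows "smooth (divergence X)"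
proof -
  have "divergence X = (\<lambda>x. \<Sum>i\<in>UNIV. pderivative i (\<lambda>x. X x $ i) x)"
    using assms by (auto simp: divergence_eq smooth_field_def)
  then show ?thesis
    using assms by (auto intro!: smooth_intros simp: smooth_field_def)
qed

lemma differential_lie_density:
  assumes "smooth_field X" "differential A"
  shows "differential (\<lambda>f. lie_density lam X (A f))"
  unfolding lie_density_def deriv_along_def
  using assms smooth_divergence[OF assms(1)]
  by (intro differential_add differential_sum differential_mult differential_pderivative smooth_intros)
    (auto simp: smooth_field_def)

text \<open>A symbol map is injective only on \<open>diffops\<close>, so equivariance passes to its
  inverse only after Lie derivatives are known to stay there.\<close>

lemma lie_operator_in_diffops:
  assumes "smooth_field X" "A \<in> diffops"
  shows "lie_operator lam mu X A \<in> diffops"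
proof -
  have A: "differential A" using assms(2) by (simp add: diffops_iff)
  have "differential (\<lambda>f x. lie_density mu X (A f) x + (- 1) * A (lie_density lam X f) x)"
    by (intro differential_add differential_mult differential_lie_density differential_comp[OF A]
        differential_id smooth_const assms(1) A)
  then have "differential (lie_operator lam mu X A)"
    by (rule differential_cong) (simp add: lie_operator_def fun_eq_iff)
  then show ?thesis by (simp add: diffops_iff lie_operator_def)
qed

lemma add_in_diffops: "A \<in> diffops \<Longrightarrow> B \<in> diffops \<Longrightarrow> A + B \<in> diffops"
  using differential_add[of A B] by (simp add: diffops_iff plus_fun_def zero_fun_def)

lemma scaleR_in_diffops: "A \<in> diffops \<Longrightarrow> c *\<^sub>R A \<in> diffops"
  using differential_mult[OF smooth_const, of A c] by (simp add: diffops_iff scaleR_fun_def fun_eq_iff zero_fun_def)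

lemma smooth_field_sl:
  assumes "X \<in> sl_fields"
  shows "smooth_field X"
proof -
  have 1: "smooth_field (X + Y)" if "smooth_field X" "smooth_field Y" for X Y :: "'a vector_field"
    using that by (auto simp: smooth_field_def plus_fun_def intro!: smooth_intros)
  have 2: "smooth_field (c *\<^sub>R X)" if "smooth_field X" for c and X :: "'a vector_field"
    using that by (auto simp: smooth_field_def scaleR_fun_def intro!: smooth_intros)
  have bl: "bounded_linear (\<lambda>x::real^'a. x $ j)" for j by (rule bounded_linear_vec_nth)
  have nth: "(\<lambda>x::real^'a. x $ j) differentiable at x" for x j
    by (intro bounded_linear_imp_differentiable bl)
  have "smooth_field X" if "X \<in> range const_field \<union> (\<Union>j. range (linear_field j)) \<union> range quadratic_field"
    for X :: "'a vector_field"
    using that by (auto simp: smooth_field_def const_field_def linear_field_def quadratic_field_def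
        intro!: smooth_intros differentiable_scaleR nth)
  note generators = this
  have 0: "smooth_field (0 :: 'a vector_field)"
    by (simp add: smooth_field_def zero_fun_def smooth_const)
  from assms show ?thesis
    unfolding sl_fields_def
    by (induction rule: span_induct_alt) (blast intro: 0 1 2 generators)+
qed

section \<open>Monomials and the Euler operator\<close>

lemma monomial_upd_Suc: "monomial (\<alpha>(i := Suc (\<alpha> i))) \<xi> = \<xi> $ i * monomial \<alpha> \<xi>"
proof -
  have "monomial (\<alpha>(i := Suc (\<alpha> i))) \<xi> =
      \<xi> $ i ^ Suc (\<alpha> i) * (\<Prod>j\<in>UNIV - {i}. (\<xi> $ j) ^ (\<alpha>(i := Suc (\<alpha> i))) j)"
    unfolding monomial_def by (subst prod.remove[of _ i]) auto
  also have "(\<Prod>j\<in>UNIV - {i}. (\<xi> $ j) ^ (\<alpha>(i := Suc (\<alpha> i))) j) = (\<Prod>j\<in>UNIV - {i}. (\<xi> $ j) ^ \<alpha> j)"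
    by (rule prod.cong) auto
  also have "\<xi> $ i ^ Suc (\<alpha> i) * \<dots> = \<xi> $ i * (\<xi> $ i ^ \<alpha> i * (\<Prod>j\<in>UNIV - {i}. (\<xi> $ j) ^ \<alpha> j))"
    by simp
  also have "\<xi> $ i ^ \<alpha> i * (\<Prod>j\<in>UNIV - {i}. (\<xi> $ j) ^ \<alpha> j) = monomial \<alpha> \<xi>"
    unfolding monomial_def by (subst prod.remove[of _ i]) auto
  finally show ?thesis .
qed

lemma monomial_has_derivative:
  "((\<lambda>\<xi>. monomial \<alpha> (\<xi> - x0)) has_derivative
    (\<lambda>h. \<Sum>i\<in>UNIV. h $ i * (real (\<alpha> i) * monomial (\<alpha>(i := \<alpha> i - 1)) (\<xi> - x0)))) (at \<xi>)"
proof -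
  have "((\<lambda>\<xi>. \<Prod>i\<in>UNIV. ((\<xi> - x0) $ i) ^ \<alpha> i) has_derivative
      (\<lambda>h. \<Sum>i\<in>UNIV. (real (\<alpha> i) * (h $ i * ((\<xi> - x0) $ i) ^ (\<alpha> i - 1))) *
        (\<Prod>j\<in>UNIV - {i}. ((\<xi> - x0) $ j) ^ \<alpha> j))) (at \<xi>)"
  proof (rule has_derivative_prod)
    fix i
    have "((\<lambda>\<xi>. (\<xi> - x0) $ i) has_derivative (\<lambda>h. h $ i)) (at \<xi>)"
      unfolding vector_minus_component
      by (auto intro!: derivative_eq_intros bounded_linear_imp_has_derivative bounded_linear_vec_nth)
    from has_derivative_power[OF this, of "\<alpha> i"]
    show "((\<lambda>\<xi>. ((\<xi> - x0) $ i) ^ \<alpha> i) has_derivative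
      (\<lambda>h. real (\<alpha> i) * (h $ i * ((\<xi> - x0) $ i) ^ (\<alpha> i - 1)))) (at \<xi>)"
      by (simp add: mult_ac)
  qed
  moreover have "((\<xi> - x0) $ i) ^ (\<alpha> i - 1) * (\<Prod>j\<in>UNIV - {i}. ((\<xi> - x0) $ j) ^ \<alpha> j) =
      monomial (\<alpha>(i := \<alpha> i - 1)) (\<xi> - x0)" for i
    unfolding monomial_def by (subst prod.remove[of _ i]) (auto intro!: prod.cong)
  ultimately show ?thesis
    unfolding monomial_def[symmetric] by (elim has_derivative_eq_rhs) (simp add: mult_ac)
qed

lemma pderivative_monomial:
  "pderivative i (\<lambda>\<xi>. monomial \<alpha> (\<xi> - x0)) \<xi> = real (\<alpha> i) * monomial (\<alpha>(i := \<alpha> i - 1)) (\<xi> - x0)"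
  using pderivativeI[OF monomial_has_derivative, of i]
  by (simp add: axis_def if_distrib[of "\<lambda>c. c * _"] cong: if_cong)

lemma pderivative_monomial_0:
  "pderivative i (monomial \<alpha>) \<xi> = real (\<alpha> i) * monomial (\<alpha>(i := \<alpha> i - 1)) \<xi>"
  using pderivative_monomial[of i \<alpha> 0 \<xi>] by simp

lemma smooth_monomial_0: "smooth (monomial \<alpha>)"
  using smooth_monomial[of \<alpha> 0] by simp

lemma monomial_upd_down:
  "\<xi> $ i * (real (\<alpha> i) * monomial (\<alpha>(i := \<alpha> i - 1)) \<xi>) = real (\<alpha> i) * monomial \<alpha> \<xi>"
proof (cases "\<alpha> i = 0")
  case False
  then have "\<alpha> = (\<alpha>(i := \<alpha> i - 1))(i := Suc ((\<alpha>(i := \<alpha> i - 1)) i))" by auto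
  then have "monomial \<alpha> \<xi> = \<xi> $ i * monomial (\<alpha>(i := \<alpha> i - 1)) \<xi>"
    by (metis monomial_upd_Suc)
  then show ?thesis by simp
qed simp

lemma euler_monomial: "euler x0 (\<lambda>x. monomial \<beta> (x - x0)) x = real (mdegree \<beta>) * monomial \<beta> (x - x0)"
  by (simp only: euler_def pderivative_monomial monomial_upd_down mdegree_def of_nat_sum sum_distrib_right)

lemma euler_monomial_0: "euler 0 (monomial \<beta>) x = real (mdegree \<beta>) * monomial \<beta> x"
  using euler_monomial[of 0 \<beta> x] by simp

lemma monomial_scaleR: "monomial \<alpha> (c *\<^sub>R \<xi>) = c ^ mdegree \<alpha> * monomial \<alpha> \<xi>"
  by (simp add: monomial_def mdegree_def power_mult_distrib prod.distrib power_sum)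

lemma frechet_derivative_euler:
  "f differentiable at x \<Longrightarrow> frechet_derivative f (at x) (x - x0) = euler x0 f x"
  unfolding euler_def by (rule frechet_derivative_pderivative)

lemma smooth_euler: "smooth f \<Longrightarrow> smooth (euler x0 f)"
  unfolding euler_def vector_minus_component by (intro smooth_intros)

lemma euler_sum:
  assumes "\<And>a. a \<in> S \<Longrightarrow> smooth (f a)"
  shows "euler x0 (\<lambda>x. \<Sum>a\<in>S. f a x) x = (\<Sum>a\<in>S. euler x0 (f a) x)"
  unfolding euler_def
  by (subst sum.swap) (simp add: pderivative_sum smooth_differentiable assms sum_distrib_left)

lemma euler_mult:
  "smooth f \<Longrightarrow> smooth g \<Longrightarrow> euler x0 (\<lambda>x. f x * g x) x = f x * euler x0 g x + euler x0 f x * g x"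
  by (simp add: euler_def pderivative_mult smooth_differentiable distrib_left sum.distrib
      sum_distrib_left sum_distrib_right mult_ac)

lemma monomial_single: "monomial (\<lambda>j. if j = i then n else 0) \<xi> = \<xi> $ i ^ n"
  by (simp add: monomial_def if_distrib[of "\<lambda>n. _ ^ n"] cong: if_cong)

lemma mdegree_single: "mdegree (\<lambda>j. if j = i then n else 0) = n"
  by (simp add: mdegree_def)

lemma euler_coordinate: "euler x0 (\<lambda>x. (x - x0) $ i) x = (x - x0) $ i"
  using euler_monomial[of x0 "\<lambda>j. if j = i then 1 else 0" x]
  by (simp only: monomial_single mdegree_single power_one_right of_nat_1 mult_1)

lemma monomial_in_span: "(\<lambda>x. monomial \<beta> (x - x0)) \<in> span (range (\<lambda>\<beta> x. monomial \<beta> (x - x0)))"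
  by (rule span_base) (rule rangeI)

lemma span_monomials_mult:
  assumes "p \<in> span (range (\<lambda>\<beta> x. monomial \<beta> (x - x0)))"
  shows "(\<lambda>x. (x - x0) $ i * p x) \<in> span (range (\<lambda>\<beta> x. monomial \<beta> (x - x0)))"
  using assms
proof (induction rule: span_induct_alt)
  case base
  then show ?case using span_zero[of "range (\<lambda>\<beta> x. monomial \<beta> (x - x0))"]
    by (simp add: zero_fun_def)
next
  case (step c b p)
  then obtain \<beta> where b: "b = (\<lambda>x. monomial \<beta> (x - x0))" by auto
  have "(\<lambda>x. (x - x0) $ i * (c *\<^sub>R b + p) x) =
      c *\<^sub>R (\<lambda>x. monomial (\<beta>(i := Suc (\<beta> i))) (x - x0)) + (\<lambda>x. (x - x0) $ i * p x)"
    by (simp add: b fun_eq_iff monomial_upd_Suc distrib_left)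
  then show ?case
    by (simp only:) (intro span_add span_scale monomial_in_span step.IH)
qed

lemma span_sum_apply:
  assumes "\<And>a. a \<in> A \<Longrightarrow> p a \<in> span S"
  shows "(\<lambda>x. \<Sum>a\<in>A. p a x) \<in> span S"
  using assms
proof (induction A rule: infinite_finite_induct)
  case (insert a A)
  then have "p a + (\<lambda>x. \<Sum>a\<in>A. p a x) \<in> span S" by (intro span_add) auto
  then show ?case using insert.hyps by (simp add: plus_fun_def)
qed (use span_zero[of S] in \<open>simp_all add: zero_fun_def\<close>)

text \<open>For \<open>\<kappa> \<ge> 1\<close> a ray integral solves
  \<open>g = (E + \<kappa>) h\<close> outright. For \<open>\<kappa> = - n \<le> 0\<close> this is
  impossible in general, because the Taylor part of degree \<open>n\<close> at \<open>x0\<close> of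
  \<open>(E - n) h\<close> is always 0; this is where the polynomial comes in. The descent from
  \<open>\<kappa> = 1\<close> uses \<open>(E + s - 1) (y_i h) = y_i (E + s) h\<close> on the terms
  of Hadamard's expansion, whose constant term goes into the polynomial.\<close>

lemma euler_equation:
  fixes g :: "'m::finite scalar_field" and \<kappa> :: int
  assumes "smooth g"
  shows "\<exists>p h. p \<in> span (range (\<lambda>\<beta> x. monomial \<beta> (x - x0))) \<and> smooth h \<and>
    g = (\<lambda>x. p x + (euler x0 h x + of_int \<kappa> * h x))"
proof (cases "\<kappa> \<ge> 1")
  case True
  then obtain n where n: "\<kappa> = int n + 1" using zle_iff_zadd[of 1 \<kappa>] by auto
  have "smooth (ray_integral x0 (\<lambda>t. t ^ n) g)"
    by (intro smooth_ray_integral assms continuous_intros)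
  moreover have "g x = 0 + (euler x0 (ray_integral x0 (\<lambda>t. t ^ n) g) x
      + of_int \<kappa> * ray_integral x0 (\<lambda>t. t ^ n) g x)" for x
    using euler_ray_integral[OF assms, of x0 n x] by (simp add: n)
  ultimately show ?thesis
    using span_zero[of "range (\<lambda>\<beta> x. monomial \<beta> (x - x0))"]
    by (intro exI[of _ 0] exI[of _ "ray_integral x0 (\<lambda>t. t ^ n) g"]) (auto simp: zero_fun_def)
next
  case False
  define n where "n = nat (- \<kappa>)"
  have \<kappa>: "\<kappa> = - int n" using False by (simp add: n_def)
  have start: "\<exists>p h. p \<in> span (range (\<lambda>\<beta> x. monomial \<beta> (x - x0))) \<and> smooth h \<and>
    g = (\<lambda>x. p x + (euler x0 h x + 1 * h x))" if "smooth g" for g :: "'m scalar_field"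
  proof -
    have "smooth (ray_integral x0 (\<lambda>t. t ^ 0) g)"
      by (intro smooth_ray_integral that continuous_intros)
    then show ?thesis
      using span_zero[of "range (\<lambda>\<beta> x. monomial \<beta> (x - x0))"] euler_ray_integral[OF that, of x0 0]
      by (intro exI[of _ 0] exI[of _ "ray_integral x0 (\<lambda>t. t ^ 0) g"]) (auto simp: zero_fun_def)
  qed
  have step: "\<exists>p h. p \<in> span (range (\<lambda>\<beta> x. monomial \<beta> (x - x0))) \<and> smooth h \<and>
      g = (\<lambda>x. p x + (euler x0 h x + (s - 1) * h x))"
    if IH: "\<And>g :: 'm scalar_field. smooth g \<Longrightarrow> \<exists>p h. p \<in> span (range (\<lambda>\<beta> x. monomial \<beta> (x - x0))) \<and> smooth h \<and>
      g = (\<lambda>x. p x + (euler x0 h x + s * h x))" and g: "smooth g" for g :: "'m scalar_field" and s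
  proof -
    let ?g = "\<lambda>i. ray_integral x0 (\<lambda>_. 1) (pderivative i g)"
    have "smooth (?g i)" for i
      by (intro smooth_ray_integral smooth_pderivative g continuous_intros)
    note smg = this
    define Q where "Q = (\<lambda>i p h. p \<in> span (range (\<lambda>\<beta> x. monomial \<beta> (x - x0))) \<and> smooth h \<and>
      ?g i = (\<lambda>x. p x + (euler x0 h x + s * h x)))"
    have "\<exists>p h. Q i p h" for i
      unfolding Q_def by (rule IH[OF smg])
    then obtain p h where "\<And>i. Q i (p i) (h i)" by metis
    then have ph: "\<And>i. p i \<in> span (range (\<lambda>\<beta> x. monomial \<beta> (x - x0)))" "\<And>i. smooth (h i)"
      "\<And>i. ?g i = (\<lambda>x. p i x + (euler x0 (h i) x + s * h i x))"
      unfolding Q_def by simp_all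
    have smy: "smooth (\<lambda>x. (x - x0) $ i)" for i
      unfolding vector_minus_component by (intro smooth_intros)
    define P where "P = g x0 *\<^sub>R (\<lambda>x. monomial (\<lambda>_. 0) (x - x0)) + (\<lambda>x. \<Sum>i\<in>UNIV. (x - x0) $ i * p i x)"
    define H where "H = (\<lambda>x. \<Sum>i\<in>UNIV. (x - x0) $ i * h i x)"
    have "P \<in> span (range (\<lambda>\<beta> x. monomial \<beta> (x - x0)))"
      unfolding P_def
      by (intro span_add span_scale monomial_in_span span_sum_apply span_monomials_mult ph)
    moreover have "smooth H"
      unfolding H_def by (intro smooth_sum smooth_mult smy ph)
    moreover have "g x = P x + (euler x0 H x + (s - 1) * H x)" for x
    proof -
      have "euler x0 H x = (\<Sum>i\<in>UNIV. (x - x0) $ i * euler x0 (h i) x + (x - x0) $ i * h i x)"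
        unfolding H_def by (simp only: euler_sum smooth_mult smy ph euler_mult euler_coordinate)
      then have "P x + (euler x0 H x + (s - 1) * H x) =
          g x0 + (\<Sum>i\<in>UNIV. (x - x0) $ i * ?g i x)"
        unfolding ph(3) H_def P_def
        by (simp add: monomial_def algebra_simps sum.distrib sum_subtractf sum_distrib_left)
      then show ?thesis using hadamard[OF g, of x x0] by simp
    qed
    ultimately show ?thesis by blast
  qed
  have "\<exists>p h. p \<in> span (range (\<lambda>\<beta> x. monomial \<beta> (x - x0))) \<and> smooth h \<and>
      g = (\<lambda>x. p x + (euler x0 h x + (- real n) * h x))" if "smooth g" for g :: "'m scalar_field"
    using that
  proof (induction n arbitrary: g)
    case 0
    show ?case using step[OF start 0] by simp
  next
    case (Suc n)
    show ?case using step[OF Suc.IH Suc.prems] by (simp add: algebra_simps)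
  qed
  from this[OF assms] show ?thesis by (simp add: \<kappa>)
qed

section \<open>Lie derivatives of symbols\<close>

lemma sym_fieldsE:
  assumes "P \<in> sym_fields k"
  obtains a where "\<And>\<alpha>. smooth (a \<alpha>)" "P = poly_field k a"
  using assms unfolding sym_fields_def by blast

lemma poly_field_in_sym_fields: "(\<And>\<alpha>. smooth (a \<alpha>)) \<Longrightarrow> poly_field k a \<in> sym_fields k"
  unfolding sym_fields_def by blast

lemma sym_fields_add:
  assumes "P \<in> sym_fields k" "Q \<in> sym_fields k"
  shows "P + Q \<in> sym_fields k"
proof -
  obtain a where a: "\<And>\<alpha>. smooth (a \<alpha>)" "P = poly_field k a" by (rule sym_fieldsE[OF assms(1)]) (rule that)
  obtain b where b: "\<And>\<alpha>. smooth (b \<alpha>)" "Q = poly_field k b" by (rule sym_fieldsE[OF assms(2)]) (rule that)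
  have "P + Q = poly_field k (\<lambda>\<alpha> x. a \<alpha> x + b \<alpha> x)"
    by (simp add: a b poly_field_def fun_eq_iff distrib_right sum.distrib)
  then show ?thesis by (auto intro!: poly_field_in_sym_fields smooth_add a b)
qed

lemma sym_fields_scaleR:
  assumes "P \<in> sym_fields k"
  shows "c *\<^sub>R P \<in> sym_fields k"
proof -
  obtain a where a: "\<And>\<alpha>. smooth (a \<alpha>)" "P = poly_field k a" by (rule sym_fieldsE[OF assms(1)]) (rule that)
  have "c *\<^sub>R P = poly_field k (\<lambda>\<alpha> x. c * a \<alpha> x)"
    by (simp add: a poly_field_def fun_eq_iff sum_distrib_left mult_ac)
  then show ?thesis by (auto intro!: poly_field_in_sym_fields smooth_mult smooth_const a)
qed

lemma sym_fields_zero: "(0 :: 'm::finite tensor_field) \<in> sym_fields k"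
proof -
  have "poly_field k (\<lambda>_ _. 0) = (0 :: 'm tensor_field)" by (simp add: poly_field_def fun_eq_iff)
  then show ?thesis
    using poly_field_in_sym_fields[of "\<lambda>_ (_ :: real ^ 'm). 0" k] by (simp add: smooth_const)
qed

definition mono_tensor :: "'m::finite scalar_field \<Rightarrow> ('m \<Rightarrow> nat) \<Rightarrow> 'm tensor_field"
  where "mono_tensor g \<alpha> = (\<lambda>x \<xi>. g x * monomial \<alpha> \<xi>)"

lemma mono_tensor_in_sym_fields:
  assumes "smooth g" "mdegree \<alpha> = k"
  shows "mono_tensor g \<alpha> \<in> sym_fields k"
proof -
  have "mono_tensor g \<alpha> = poly_field k (\<lambda>\<beta>. if \<beta> = \<alpha> then g else (\<lambda>_. 0))"
  proof (intro ext)
    fix x \<xi>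
    have "poly_field k (\<lambda>\<beta>. if \<beta> = \<alpha> then g else (\<lambda>_. 0)) x \<xi> =
        (\<Sum>\<beta> | mdegree \<beta> = k. if \<beta> = \<alpha> then g x * monomial \<beta> \<xi> else 0)"
      unfolding poly_field_def by (rule sum.cong) auto
    then show "mono_tensor g \<alpha> x \<xi> = poly_field k (\<lambda>\<beta>. if \<beta> = \<alpha> then g else (\<lambda>_. 0)) x \<xi>"
      by (simp add: finite_mdegree_eq assms mono_tensor_def)
  qed
  then show ?thesis
    using assms by (auto intro!: poly_field_in_sym_fields smooth_const)
qed

lemma poly_field_eq_sum: "poly_field k a = (\<Sum>\<alpha> | mdegree \<alpha> = k. mono_tensor (a \<alpha>) \<alpha>)"
proof -
  have "(\<Sum>\<alpha>\<in>S. mono_tensor (a \<alpha>) \<alpha>) x \<xi> = (\<Sum>\<alpha>\<in>S. a \<alpha> x * monomial \<alpha> \<xi>)" for S x \<xi>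
    by (induction S rule: infinite_finite_induct) (auto simp: mono_tensor_def)
  then show ?thesis by (simp add: fun_eq_iff poly_field_def)
qed

lemma sym_fields_smooth: "P \<in> sym_fields k \<Longrightarrow> smooth (\<lambda>x. P x \<xi>)"
  by (erule sym_fieldsE) (simp add: poly_field_def smooth_intros)

lemma sym_fields_smooth_fibre: "P \<in> sym_fields k \<Longrightarrow> smooth (P x)"
  by (erule sym_fieldsE) (simp add: poly_field_def smooth_intros smooth_monomial_0)

lemma sym_fields_homogeneous: "P \<in> sym_fields k \<Longrightarrow> P x (c *\<^sub>R \<xi>) = c ^ k * P x \<xi>"
  by (erule sym_fieldsE) (simp add: poly_field_def monomial_scaleR sum_distrib_left mult_ac)

lemma sym_fields_euler:
  assumes "P \<in> sym_fields k"
  shows "frechet_derivative (P x) (at \<xi>) \<xi> = real k * P x \<xi>"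
proof -
  have "frechet_derivative (P x) (at \<xi>) \<xi> = euler 0 (P x) \<xi>"
    using frechet_derivative_euler[of "P x" \<xi> 0] sym_fields_smooth_fibre[OF assms, of x]
    by (simp add: smooth_differentiable)
  also have "\<dots> = real k * P x \<xi>"
  proof -
    obtain a where a: "\<And>\<alpha>. smooth (a \<alpha>)" "P = poly_field k a" by (rule sym_fieldsE[OF assms]) (rule that)
    have "euler 0 (\<lambda>\<xi>. \<Sum>\<alpha> | mdegree \<alpha> = k. a \<alpha> x * monomial \<alpha> \<xi>) \<xi> =
        (\<Sum>\<alpha> | mdegree \<alpha> = k. a \<alpha> x * (real (mdegree \<alpha>) * monomial \<alpha> \<xi>))"
      by (simp add: euler_sum euler_mult smooth_intros smooth_monomial_0 euler_monomial_0)
        (simp add: euler_def pderivative_const)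
    also have "\<dots> = real k * P x \<xi>"
      by (simp add: a poly_field_def sum_distrib_left mult_ac)
    finally show ?thesis by (simp add: a poly_field_def)
  qed
  finally show ?thesis .
qed

lemma deriv_along_eq: "f differentiable at x \<Longrightarrow> deriv_along X f x = frechet_derivative f (at x) (X x)"
  by (simp add: deriv_along_def frechet_derivative_pderivative)

lemma deriv_along_add:
  "smooth f \<Longrightarrow> smooth g \<Longrightarrow> deriv_along X (\<lambda>x. f x + g x) x = deriv_along X f x + deriv_along X g x"
  by (simp add: deriv_along_def pderivative_add smooth_differentiable distrib_left sum.distrib)

lemma pderivative_cmult: "smooth f \<Longrightarrow> pderivative i (\<lambda>x. c * f x) x = c * pderivative i f x"
  by (simp add: pderivative_mult pderivative_const smooth_differentiable smooth_const)

lemma deriv_along_cmult: "smooth f \<Longrightarrow> deriv_along X (\<lambda>x. c * f x) x = c * deriv_along X f x"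
  by (simp add: deriv_along_def pderivative_cmult sum_distrib_left mult_ac)

lemma rho_add:
  assumes "smooth p" "smooth q"
  shows "rho A (p + q) \<xi> = rho A p \<xi> + rho A q \<xi>"
  using assms
  by (simp add: plus_fun_def rho_def frechet_derivative_pderivative smooth_differentiable smooth_add
      pderivative_add distrib_left sum.distrib)

lemma rho_cmult:
  assumes "smooth p"
  shows "rho A (c *\<^sub>R p) \<xi> = c * rho A p \<xi>"
  using assms
  by (simp add: scaleR_fun_def rho_def frechet_derivative_pderivative smooth_differentiable smooth_mult smooth_const
      pderivative_cmult sum_distrib_left mult_ac)

lemma lie_tensor_add:
  assumes "P \<in> sym_fields k" "Q \<in> sym_fields l"
  shows "lie_tensor \<delta> X (P + Q) = lie_tensor \<delta> X P + lie_tensor \<delta> X Q"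
  using sym_fields_smooth[OF assms(1)] sym_fields_smooth_fibre[OF assms(1)]
    sym_fields_smooth[OF assms(2)] sym_fields_smooth_fibre[OF assms(2)]
  by (simp add: lie_tensor_def fun_eq_iff deriv_along_add rho_add distrib_left)

lemma lie_tensor_scaleR:
  assumes "P \<in> sym_fields k"
  shows "lie_tensor \<delta> X (c *\<^sub>R P) = c *\<^sub>R lie_tensor \<delta> X P"
  using sym_fields_smooth[OF assms(1)] sym_fields_smooth_fibre[OF assms(1)]
  by (simp add: lie_tensor_def fun_eq_iff deriv_along_cmult rho_cmult distrib_left right_diff_distrib)

lemma lie_tensor_zero: "lie_tensor \<delta> X 0 = 0"
  using lie_tensor_scaleR[OF sym_fields_zero, of \<delta> X 0] by simp

section \<open>Lie derivatives through the Jacobian, and fields centred at a point\<close>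

lemma jacobianI:
  fixes J :: "real ^ 'm::finite ^ 'm"
  assumes "(X has_derivative (*v) J) (at x)"
  shows "jacobian X (at x) = J"
  using matrix_of_matrix_vector_mul[of J]
  by (simp add: jacobian_def frechet_derivative_at[OF assms, symmetric])

lemma lie_tensor_mono_tensor:
  assumes "(X has_derivative (*v) J) (at x)" "smooth g"
  shows "lie_tensor \<delta> X (mono_tensor g \<alpha>) x \<xi> =
    frechet_derivative g (at x) (X x) * monomial \<alpha> \<xi>
    - g x * frechet_derivative (monomial \<alpha>) (at \<xi>) (transpose J *v \<xi>)
    + \<delta> * trace J * (g x * monomial \<alpha> \<xi>)"
proof -
  have "rho J (\<lambda>\<xi>. g x * monomial \<alpha> \<xi>) \<xi> = g x * rho J (monomial \<alpha>) \<xi>"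
    using rho_cmult[OF smooth_monomial_0, of J "g x" \<alpha> \<xi>] by (simp add: scaleR_fun_def)
  moreover have "deriv_along X (\<lambda>y. monomial \<alpha> \<xi> * g y) x = monomial \<alpha> \<xi> * frechet_derivative g (at x) (X x)"
    by (simp add: deriv_along_cmult deriv_along_eq smooth_differentiable assms(2))
  ultimately show ?thesis
    by (simp add: lie_tensor_def mono_tensor_def jacobianI[OF assms(1)] rho_def mult.commute)
qed

lemma lie_tensor_vanishing_field:
  assumes "(X has_derivative (*v) J) (at x)" "X x = 0"
  shows "lie_tensor \<delta> X P x \<xi> =
    - frechet_derivative (P x) (at \<xi>) (transpose J *v \<xi>) + \<delta> * trace J * P x \<xi>"
  by (simp add: lie_tensor_def jacobianI[OF assms(1)] rho_def deriv_along_def assms(2))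

text \<open>This is \<open>c\<close> times the identity plus the rank-one matrix
  \<open>v e_j^T\<close>. With \<open>c = y_j\<close> and \<open>v = y\<close> it is the Jacobian of
  the quadratic field \<open>y_j y\<close>.\<close>

definition shear :: "real \<Rightarrow> 'm::finite \<Rightarrow> real ^ 'm \<Rightarrow> real ^ 'm ^ 'm"
  where "shear c j v = (\<chi> r s. (if r = s then c else 0) + (if s = j then v $ r else 0))"

lemma if_zero_mult: "(if b then c else 0) * (d::real) = (if b then c * d else 0)"
  by simp

lemma shear_mult: "shear c j v *v h = c *\<^sub>R h + (h $ j) *\<^sub>R v"
  by (simp add: shear_def vec_eq_iff matrix_vector_mult_def distrib_right sum.distrib if_zero_mult)

lemma transpose_shear_mult: "transpose (shear c j v) *v h = c *\<^sub>R h + (v \<bullet> h) *\<^sub>R axis j 1"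
proof -
  have "(\<Sum>s\<in>UNIV. (if i = j then v $ s else 0) * h $ s) = (v \<bullet> h) * axis j 1 $ i" for i
    by (simp add: inner_vec_def axis_def)
  then show ?thesis
    by (simp add: shear_def transpose_def vec_eq_iff matrix_vector_mult_def distrib_right sum.distrib if_zero_mult)
qed

lemma trace_shear: "trace (shear c j v :: real ^ 'm::finite ^ 'm) = real CARD('m) * c + v $ j"
  by (simp add: shear_def trace_def sum.distrib)

definition affine_field :: "real ^ 'm::finite \<Rightarrow> real ^ 'm ^ 'm \<Rightarrow> 'm vector_field"
  where "affine_field x0 A = (\<lambda>x. A *v (x - x0))"

definition centred_quadratic_field :: "real ^ 'm::finite \<Rightarrow> 'm \<Rightarrow> 'm vector_field"
  where "centred_quadratic_field x0 j = (\<lambda>x. ((x - x0) $ j) *\<^sub>R (x - x0))"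

lemma affine_field_has_derivative: "(affine_field x0 A has_derivative (*v) A) (at x)"
proof -
  have "((\<lambda>x. x - x0) has_derivative (\<lambda>h. h)) (at x)"
    by (auto intro!: derivative_eq_intros)
  then show ?thesis unfolding affine_field_def
    by (rule bounded_linear.has_derivative[OF matrix_vector_mul_bounded_linear])
qed

lemma centred_quadratic_field_has_derivative:
  "(centred_quadratic_field x0 j has_derivative
    (*v) (shear ((x - x0) $ j) j (x - x0))) (at x)"
proof -
  have d: "((\<lambda>x. (x - x0) $ j) has_derivative (\<lambda>h. h $ j)) (at x)"
    unfolding vector_minus_component
    by (auto intro!: derivative_eq_intros bounded_linear_imp_has_derivative bounded_linear_vec_nth)
  have "((\<lambda>x. x - x0) has_derivative (\<lambda>h. h)) (at x)"
    by (auto intro!: derivative_eq_intros)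
  from has_derivative_scaleR[OF d this]
  show ?thesis unfolding centred_quadratic_field_def
    by (rule has_derivative_eq_rhs) (simp add: fun_eq_iff shear_mult)
qed

lemma sl_fields_add: "X \<in> sl_fields \<Longrightarrow> Y \<in> sl_fields \<Longrightarrow> X + Y \<in> sl_fields"
  unfolding sl_fields_def by (rule span_add)

lemma sl_fields_diff: "X \<in> sl_fields \<Longrightarrow> Y \<in> sl_fields \<Longrightarrow> X - Y \<in> sl_fields"
  unfolding sl_fields_def by (rule span_diff)

lemma sl_fields_scaleR: "X \<in> sl_fields \<Longrightarrow> c *\<^sub>R X \<in> sl_fields"
  unfolding sl_fields_def by (rule span_scale)

lemma sl_fields_sum: "(\<And>a. a \<in> S \<Longrightarrow> X a \<in> sl_fields) \<Longrightarrow> (\<lambda>x. \<Sum>a\<in>S. X a x) \<in> sl_fields"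
  unfolding sl_fields_def by (rule span_sum_apply)

lemma const_field_sl: "const_field i \<in> sl_fields"
  unfolding sl_fields_def by (rule span_base) auto

lemma linear_field_sl: "linear_field j i \<in> sl_fields"
  unfolding sl_fields_def by (rule span_base) auto

lemma quadratic_field_sl: "quadratic_field j \<in> sl_fields"
  unfolding sl_fields_def by (rule span_base) auto

lemma affine_field_sl: "affine_field x0 A \<in> sl_fields"
proof -
  have "affine_field x0 A x = (\<Sum>i\<in>UNIV. \<Sum>j\<in>UNIV.
      (A $ i $ j *\<^sub>R (linear_field j i - (x0 $ j) *\<^sub>R const_field i)) x)" for x
  proof -
    have "affine_field x0 A x = (\<Sum>i\<in>UNIV. (affine_field x0 A x $ i) *\<^sub>R axis i 1)"
      using basis_expansion[of "affine_field x0 A x"] by (simp add: scalar_mult_eq_scaleR)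
    also have "\<dots> = (\<Sum>i\<in>UNIV. (\<Sum>j\<in>UNIV. A $ i $ j * (x $ j - x0 $ j)) *\<^sub>R axis i 1)"
      by (simp add: affine_field_def matrix_vector_mult_def)
    finally show ?thesis
      by (simp add: linear_field_def const_field_def scaleR_sum_left algebra_simps)
  qed
  then have "affine_field x0 A = (\<lambda>x. \<Sum>i\<in>UNIV. \<Sum>j\<in>UNIV.
      (A $ i $ j *\<^sub>R (linear_field j i - (x0 $ j) *\<^sub>R const_field i)) x)"
    by (rule ext)
  then show ?thesis
    by (simp only:) (intro sl_fields_sum sl_fields_scaleR sl_fields_diff linear_field_sl const_field_sl)
qed

text \<open>Expand \<open>(x - x0)_j (x - x0)\<close>. The terms linear in \<open>x\<close> are
  \<open>- (x0_j x + x_j x0)\<close>, which is minus the action of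
  \<open>shear (x0 $ j) j x0\<close>; the constant term is \<open>x0_j x0\<close>.\<close>

lemma centred_quadratic_field_sl: "centred_quadratic_field x0 j \<in> sl_fields"
proof -
  have "centred_quadratic_field x0 j x = (quadratic_field j - affine_field 0 (shear (x0 $ j) j x0)
      + (\<lambda>x. \<Sum>i\<in>UNIV. ((x0 $ j * x0 $ i) *\<^sub>R const_field i) x)) x" for x
  proof -
    have "(x0 $ j) *\<^sub>R x0 = (\<Sum>i\<in>UNIV. (x0 $ j * x0 $ i) *\<^sub>R axis i 1)"
      by (subst basis_expansion[of x0, symmetric]) (simp add: scalar_mult_eq_scaleR scaleR_sum_right)
    then show ?thesis
      by (simp add: centred_quadratic_field_def quadratic_field_def affine_field_def const_field_def
          shear_mult algebra_simps)
  qed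
  then have "centred_quadratic_field x0 j = quadratic_field j - affine_field 0 (shear (x0 $ j) j x0)
      + (\<lambda>x. \<Sum>i\<in>UNIV. ((x0 $ j * x0 $ i) *\<^sub>R const_field i) x)"
    by (rule ext)
  then show ?thesis
    by (simp only:) (intro sl_fields_add sl_fields_sum sl_fields_scaleR sl_fields_diff
        affine_field_sl quadratic_field_sl const_field_sl)
qed

lemma frechet_derivative_axis:
  fixes f :: "'m::finite scalar_field"
  assumes "f differentiable at x"
  shows "frechet_derivative f (at x) (c *\<^sub>R axis i 1) = c * pderivative i f x"
  using linear_frechet_derivative[OF assms] by (simp add: linear_cmul pderivative_def)

lemma smooth_has_frechet_derivative:
  "smooth f \<Longrightarrow> (f has_derivative frechet_derivative f (at x)) (at x)"
  using smooth_differentiable by (simp add: frechet_derivative_works[symmetric])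

section \<open>Lie derivatives of monomial tensors\<close>

abbreviation up :: "'m \<Rightarrow> ('m \<Rightarrow> nat) \<Rightarrow> 'm \<Rightarrow> nat"
  where "up i \<alpha> \<equiv> \<alpha>(i := Suc (\<alpha> i))"

abbreviation down :: "'m \<Rightarrow> ('m \<Rightarrow> nat) \<Rightarrow> 'm \<Rightarrow> nat"
  where "down i \<alpha> \<equiv> \<alpha>(i := \<alpha> i - 1)"

abbreviation single :: "'m \<Rightarrow> nat \<Rightarrow> 'm \<Rightarrow> nat"
  where "single i n \<equiv> (\<lambda>j. if j = i then n else 0)"

lemma mdegree_up: "mdegree (up i \<alpha>) = Suc (mdegree \<alpha>)"
proof -
  have "mdegree (up i \<alpha>) = Suc (\<alpha> i) + (\<Sum>j\<in>UNIV - {i}. up i \<alpha> j)"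
    unfolding mdegree_def by (subst sum.remove[of _ i]) auto
  also have "(\<Sum>j\<in>UNIV - {i}. up i \<alpha> j) = (\<Sum>j\<in>UNIV - {i}. \<alpha> j)"
    by (rule sum.cong) auto
  also have "Suc (\<alpha> i) + \<dots> = Suc (mdegree \<alpha>)"
    unfolding mdegree_def by (subst sum.remove[of _ i]) auto
  finally show ?thesis .
qed

lemma up_down: "\<alpha> i > 0 \<Longrightarrow> up i (down i \<alpha>) = \<alpha>"
  by auto

lemma mdegree_up_down: "\<alpha> i > 0 \<Longrightarrow> mdegree (up j (down i \<alpha>)) = mdegree \<alpha>"
  using mdegree_up[of "down i \<alpha>" i] mdegree_up[of "down i \<alpha>" j] up_down[of \<alpha> i] by simp

definition unit_matrix :: "'m::finite \<Rightarrow> 'm \<Rightarrow> real ^ 'm ^ 'm"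
  where "unit_matrix i j = (\<chi> r s. if r = i \<and> s = j then 1 else 0)"

lemma unit_matrix_mult: "unit_matrix i j *v y = (y $ j) *\<^sub>R axis i 1"
proof -
  have "(\<Sum>s\<in>UNIV. (if r = i \<and> s = j then 1 else 0) * y $ s) =
      (\<Sum>s\<in>UNIV. if s = j then (if r = i then y $ s else 0) else 0)" for r
    by (rule sum.cong) auto
  then show ?thesis
    by (simp add: unit_matrix_def matrix_vector_mult_def vec_eq_iff axis_def)
qed

lemma transpose_unit_matrix: "transpose (unit_matrix i j) = unit_matrix j i"
  by (auto simp: unit_matrix_def transpose_def vec_eq_iff)

lemma trace_unit_matrix: "trace (unit_matrix i j) = (if i = j then 1 else 0)"
proof -
  have "trace (unit_matrix i j) = (\<Sum>r\<in>UNIV. if r = i then (if i = j then 1 else 0) else 0)"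
    unfolding unit_matrix_def trace_def by (rule sum.cong) auto
  then show ?thesis by simp
qed

definition mono_at :: "real ^ 'm::finite \<Rightarrow> ('m \<Rightarrow> nat) \<Rightarrow> ('m \<Rightarrow> nat) \<Rightarrow> 'm tensor_field"
  where "mono_at x0 \<beta> \<alpha> = mono_tensor (\<lambda>x. monomial \<beta> (x - x0)) \<alpha>"

lemma mono_at_in_sym_fields: "mdegree \<alpha> = k \<Longrightarrow> mono_at x0 \<beta> \<alpha> \<in> sym_fields k"
  unfolding mono_at_def by (intro mono_tensor_in_sym_fields smooth_monomial)

lemma lie_tensor_euler_field:
  fixes g :: "'m::finite scalar_field"
  assumes "smooth g"
  shows "lie_tensor \<delta> (affine_field x0 (mat 1)) (mono_tensor g \<alpha>) =
    mono_tensor (\<lambda>x. euler x0 g x + (\<delta> * real CARD('m) - real (mdegree \<alpha>)) * g x) \<alpha>"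
proof (intro ext)
  fix x \<xi> :: "real ^ 'm"
  have "frechet_derivative (monomial \<alpha>) (at \<xi>) \<xi> = real (mdegree \<alpha>) * monomial \<alpha> \<xi>"
    using frechet_derivative_euler[of "monomial \<alpha>" \<xi> 0]
    by (simp add: smooth_differentiable smooth_monomial_0 euler_monomial_0)
  moreover have "trace (mat 1 :: real ^ 'm ^ 'm) = real CARD('m)"
    by (simp add: trace_def mat_def)
  ultimately show "lie_tensor \<delta> (affine_field x0 (mat 1)) (mono_tensor g \<alpha>) x \<xi> =
    mono_tensor (\<lambda>x. euler x0 g x + (\<delta> * real CARD('m) - real (mdegree \<alpha>)) * g x) \<alpha> x \<xi>"
    unfolding lie_tensor_mono_tensor[OF affine_field_has_derivative assms]
    by (simp add: affine_field_def frechet_derivative_euler smooth_differentiable assms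
        transpose_mat mono_tensor_def algebra_simps)
qed

text \<open>If \<open>\<beta> i = 0\<close> or \<open>\<alpha> j = 0\<close>, truncated subtraction
  makes the corresponding tensor on the right meaningless, but its coefficient is then 0.\<close>

lemma lie_tensor_unit_field:
  "lie_tensor \<delta> (affine_field x0 (unit_matrix i j)) (mono_at x0 \<beta> \<alpha>) =
    real (\<beta> i) *\<^sub>R mono_at x0 (up j (down i \<beta>)) \<alpha>
    + (- real (\<alpha> j)) *\<^sub>R mono_at x0 \<beta> (up i (down j \<alpha>))
    + (if i = j then \<delta> else 0) *\<^sub>R mono_at x0 \<beta> \<alpha>"
proof (intro ext)
  fix x \<xi>
  have 1: "monomial (up j (down i \<beta>)) (x - x0) = (x - x0) $ j * monomial (down i \<beta>) (x - x0)"
    by (rule monomial_upd_Suc)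
  have 2: "monomial (up i (down j \<alpha>)) \<xi> = \<xi> $ i * monomial (down j \<alpha>) \<xi>"
    by (rule monomial_upd_Suc)
  show "lie_tensor \<delta> (affine_field x0 (unit_matrix i j)) (mono_at x0 \<beta> \<alpha>) x \<xi> =
    (real (\<beta> i) *\<^sub>R mono_at x0 (up j (down i \<beta>)) \<alpha>
    + (- real (\<alpha> j)) *\<^sub>R mono_at x0 \<beta> (up i (down j \<alpha>))
    + (if i = j then \<delta> else 0) *\<^sub>R mono_at x0 \<beta> \<alpha>) x \<xi>"
    unfolding mono_at_def lie_tensor_mono_tensor[OF affine_field_has_derivative smooth_monomial]
    unfolding affine_field_def unit_matrix_mult transpose_unit_matrix trace_unit_matrix
      frechet_derivative_axis[OF smooth_differentiable[OF smooth_monomial]]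
      frechet_derivative_axis[OF smooth_differentiable[OF smooth_monomial_0]]
      pderivative_monomial pderivative_monomial_0
      plus_fun_apply scaleR_fun_apply mono_tensor_def 1 2
    by (simp add: algebra_simps)
qed

text \<open>The field is \<open>y_z E\<close>, which gives \<open>|\<beta>|\<close>. Its Jacobian is
  \<open>y_z\<close> times the identity, which gives \<open>- |\<alpha>|\<close>, plus the rank-one
  part \<open>y e_z^T\<close>, which gives the sum because it replaces one factor
  \<open>\<xi>_z\<close> by the pairing of \<open>y\<close> and \<open>\<xi>\<close>. Its trace is
  \<open>(m + 1) y_z\<close>.\<close>

lemma lie_tensor_centred_quadratic_field:
  fixes \<beta> \<alpha> :: "'m::finite \<Rightarrow> nat"
  shows "lie_tensor \<delta> (centred_quadratic_field x0 z) (mono_at x0 \<beta> \<alpha>) =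
    (real (mdegree \<beta>) - real (mdegree \<alpha>) + (real CARD('m) + 1) * \<delta>) *\<^sub>R mono_at x0 (up z \<beta>) \<alpha>
    + (- real (\<alpha> z)) *\<^sub>R (\<Sum>i\<in>UNIV. mono_at x0 (up i \<beta>) (up i (down z \<alpha>)))"
proof (intro ext)
  fix x \<xi> :: "real ^ 'm"
  let ?y = "x - x0"
  have lin: "linear (frechet_derivative f (at u))" if "smooth f" for f :: "'m scalar_field" and u
    by (rule linear_frechet_derivative[OF smooth_differentiable[OF that]])
  have 1: "frechet_derivative (\<lambda>x. monomial \<beta> (x - x0)) (at x) (centred_quadratic_field x0 z x)
      = ?y $ z * (real (mdegree \<beta>) * monomial \<beta> ?y)"
    using frechet_derivative_euler[OF smooth_differentiable[OF smooth_monomial[of \<beta> x0]], of x x0]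
    by (simp only: centred_quadratic_field_def linear_cmul[OF lin[OF smooth_monomial]] euler_monomial
        real_scaleR_def)
  have 2: "frechet_derivative (monomial \<alpha>) (at \<xi>) (transpose (shear (?y $ z) z ?y) *v \<xi>)
      = ?y $ z * (real (mdegree \<alpha>) * monomial \<alpha> \<xi>) + (?y \<bullet> \<xi>) * (real (\<alpha> z) * monomial (down z \<alpha>) \<xi>)"
    using frechet_derivative_euler[OF smooth_differentiable[OF smooth_monomial_0[of \<alpha>]], of \<xi> 0]
    by (simp only: transpose_shear_mult linear_add[OF lin[OF smooth_monomial_0]]
        linear_cmul[OF lin[OF smooth_monomial_0]] euler_monomial_0 real_scaleR_def diff_zero
        pderivative_monomial_0[unfolded pderivative_def])
  have 3: "(\<Sum>i\<in>UNIV. mono_at x0 (up i \<beta>) (up i (down z \<alpha>))) x \<xi> =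
      (?y \<bullet> \<xi>) * (monomial \<beta> ?y * monomial (down z \<alpha>) \<xi>)"
  proof -
    have "(\<Sum>i\<in>S. mono_at x0 (up i \<beta>) (up i (down z \<alpha>))) x \<xi> =
        (\<Sum>i\<in>S. monomial (up i \<beta>) ?y * monomial (up i (down z \<alpha>)) \<xi>)" for S
      by (induction S rule: infinite_finite_induct) (auto simp: mono_at_def mono_tensor_def)
    then show ?thesis
      by (simp only: monomial_upd_Suc inner_vec_def inner_real_def sum_distrib_right sum_distrib_left mult_ac)
  qed
  have 4: "mono_at x0 (up z \<beta>) \<alpha> x \<xi> = ?y $ z * monomial \<beta> ?y * monomial \<alpha> \<xi>"
    by (simp only: mono_at_def mono_tensor_def monomial_upd_Suc)
  have "lie_tensor \<delta> (centred_quadratic_field x0 z) (mono_at x0 \<beta> \<alpha>) x \<xi> =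
      ?y $ z * (real (mdegree \<beta>) * monomial \<beta> ?y) * monomial \<alpha> \<xi>
      - monomial \<beta> ?y * (?y $ z * (real (mdegree \<alpha>) * monomial \<alpha> \<xi>)
        + (?y \<bullet> \<xi>) * (real (\<alpha> z) * monomial (down z \<alpha>) \<xi>))
      + \<delta> * (real CARD('m) * ?y $ z + ?y $ z) * (monomial \<beta> ?y * monomial \<alpha> \<xi>)"
    unfolding mono_at_def lie_tensor_mono_tensor[OF centred_quadratic_field_has_derivative smooth_monomial]
      1 2 trace_shear ..
  then show "lie_tensor \<delta> (centred_quadratic_field x0 z) (mono_at x0 \<beta> \<alpha>) x \<xi> =
    ((real (mdegree \<beta>) - real (mdegree \<alpha>) + (real CARD('m) + 1) * \<delta>) *\<^sub>R mono_at x0 (up z \<beta>) \<alpha>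
    + (- real (\<alpha> z)) *\<^sub>R (\<Sum>i\<in>UNIV. mono_at x0 (up i \<beta>) (up i (down z \<alpha>)))) x \<xi>"
    unfolding plus_fun_apply scaleR_fun_apply 3 4 by (simp add: algebra_simps del: vector_minus_component)
qed

lemma sym_fields_along_line:
  assumes "P \<in> sym_fields k"
  shows "\<exists>p. \<forall>t. P x (a + t *\<^sub>R w) = poly p t"
proof -
  obtain c where c: "\<And>\<alpha>. smooth (c \<alpha>)" "P = poly_field k c" by (rule sym_fieldsE[OF assms]) (rule that)
  have "P x (a + t *\<^sub>R w) =
      poly (\<Sum>\<alpha> | mdegree \<alpha> = k. [:c \<alpha> x:] * (\<Prod>i\<in>UNIV. [:a $ i, w $ i:] ^ \<alpha> i)) t" for t
    by (simp add: c poly_field_def monomial_def poly_sum poly_prod poly_power)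
  then show ?thesis by blast
qed

section \<open>Equivariant maps between symbols\<close>

text \<open>The instances are the blocks, from degree \<open>k\<close> to degree \<open>l\<close>,
  of the conjugate of \<open>T\<close> by the symbol maps, and the diagonal blocks minus a scalar.
  For these, \<open>lie_in\<close> follows from the bijectivity of a symbol map
  (\<open>lie_tensor_in_sym_fields\<close>).\<close>

locale equivariant_map =
  fixes V :: "'m::finite tensor_field \<Rightarrow> 'm tensor_field" and k l :: nat and \<delta> :: real
  assumes V_in: "P \<in> sym_fields k \<Longrightarrow> V P \<in> sym_fields l"
    and V_add: "P \<in> sym_fields k \<Longrightarrow> Q \<in> sym_fields k \<Longrightarrow> V (P + Q) = V P + V Q"
    and V_scaleR: "P \<in> sym_fields k \<Longrightarrow> V (c *\<^sub>R P) = c *\<^sub>R V P"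
    and lie_in: "X \<in> sl_fields \<Longrightarrow> P \<in> sym_fields k \<Longrightarrow> lie_tensor \<delta> X P \<in> sym_fields k"
    and V_lie: "X \<in> sl_fields \<Longrightarrow> P \<in> sym_fields k \<Longrightarrow> V (lie_tensor \<delta> X P) = lie_tensor \<delta> X (V P)"
begin

lemma V_zero: "V 0 = 0"
  using V_scaleR[OF sym_fields_zero, of 0] by simp

lemma V_sum:
  "(\<And>a. a \<in> S \<Longrightarrow> P a \<in> sym_fields k) \<Longrightarrow>
    (\<Sum>a\<in>S. P a) \<in> sym_fields k \<and> V (\<Sum>a\<in>S. P a) = (\<Sum>a\<in>S. V (P a))"
  by (induction S rule: infinite_finite_induct)
    (auto simp: V_zero sym_fields_zero sym_fields_add V_add)

text \<open>The alternative \<open>c = 0\<close> is for the tensors that \<open>down\<close>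
  produces from a zero exponent: their degree is wrong, so nothing is known about \<open>V\<close>
  on them.\<close>

lemma V_scaled:
  assumes "c = 0 \<or> P \<in> sym_fields k"
  shows "c *\<^sub>R P \<in> sym_fields k" "V (c *\<^sub>R P) = c *\<^sub>R V P"
  using assms by (auto simp: V_zero sym_fields_zero V_scaleR sym_fields_scaleR)

text \<open>The field vanishes at \<open>x0\<close>, so only its action on the fibre survives and no
  derivative of \<open>V P\<close> in \<open>x\<close> appears.\<close>

lemma V_affine:
  assumes "P \<in> sym_fields k"
  shows "V (lie_tensor \<delta> (affine_field x0 A) P) x0 \<xi> =
    - frechet_derivative (V P x0) (at \<xi>) (transpose A *v \<xi>) + \<delta> * trace A * V P x0 \<xi>"
  unfolding V_lie[OF affine_field_sl assms]
  by (rule lie_tensor_vanishing_field[OF affine_field_has_derivative]) (simp add: affine_field_def)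

text \<open>The field vanishes to second order at \<open>x0\<close>, hence so does every term of a
  Lie derivative along it when evaluated there.\<close>

lemma V_quadratic:
  assumes "P \<in> sym_fields k"
  shows "V (lie_tensor \<delta> (centred_quadratic_field x0 z) P) x0 \<xi> = 0"
proof -
  have "centred_quadratic_field x0 z x0 = 0" by (simp add: centred_quadratic_field_def)
  moreover have "frechet_derivative (V P x0) (at \<xi>) 0 = 0"
    by (intro linear_0 linear_frechet_derivative smooth_differentiable sym_fields_smooth_fibre[OF V_in[OF assms]])
  ultimately show ?thesis
    unfolding V_lie[OF centred_quadratic_field_sl assms]
    by (simp add: lie_tensor_vanishing_field[OF centred_quadratic_field_has_derivative]
        transpose_shear_mult trace_shear del: transpose_matrix_vector)
qed

text \<open>The Euler field at \<open>x0\<close> makes \<open>V\<close> local: \<open>V\<close> followed by evaluation at \<open>x0\<close> annihilates every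
  coefficient of the form \<open>E h + (l - k) h\<close>, and those together with the polynomials exhaust all
  smooth functions.\<close>

lemma vanish_on_smooth_coefficients:
  assumes "\<And>\<beta>. V (mono_at x0 \<beta> \<alpha>) x0 \<xi> = 0" "smooth g" "mdegree \<alpha> = k"
  shows "V (mono_tensor g \<alpha>) x0 \<xi> = 0"
proof -
  obtain p h where ph: "p \<in> span (range (\<lambda>\<beta> x. monomial \<beta> (x - x0)))" "smooth h"
    "g = (\<lambda>x. p x + (euler x0 h x + of_int (int l - int k) * h x))"
    using euler_equation[OF assms(2)] by blast
  have add: "mono_tensor (\<lambda>x. f x + g x) \<alpha> = mono_tensor f \<alpha> + mono_tensor g \<alpha>"
    for f g :: "'m scalar_field"
    by (simp add: mono_tensor_def fun_eq_iff distrib_right)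
  have scale: "mono_tensor (\<lambda>x. c * f x) \<alpha> = c *\<^sub>R mono_tensor f \<alpha>" for f :: "'m scalar_field" and c
    by (simp add: mono_tensor_def fun_eq_iff)
  have p: "smooth p \<and> V (mono_tensor p \<alpha>) x0 \<xi> = 0"
    using ph(1)
  proof (induction rule: span_induct_alt)
    case base
    have z: "mono_tensor (\<lambda>_. 0) \<alpha> = 0" by (simp add: mono_tensor_def fun_eq_iff)
    have "V (mono_tensor (\<lambda>_. 0) \<alpha>) = 0" unfolding z by (rule V_zero)
    then show ?case by (simp add: zero_fun_def smooth_const)
  next
    case (step c b p)
    then obtain \<beta> where b: "b = (\<lambda>x. monomial \<beta> (x - x0))" by auto
    have e: "c *\<^sub>R b + p = (\<lambda>x. c * b x + p x)" by (simp add: fun_eq_iff)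
    have sb: "smooth b" unfolding b by (rule smooth_monomial)
    have sp: "smooth p" and p: "V (mono_tensor p \<alpha>) x0 \<xi> = 0" using step.IH by auto
    have "V (mono_tensor b \<alpha>) x0 \<xi> = 0"
      using assms(1) by (simp add: b mono_at_def)
    moreover have "V (mono_tensor (c *\<^sub>R b + p) \<alpha>) = c *\<^sub>R V (mono_tensor b \<alpha>) + V (mono_tensor p \<alpha>)"
      unfolding e add scale
      by (simp only: V_add V_scaleR mono_tensor_in_sym_fields sym_fields_scaleR sb sp assms(3))
    ultimately show ?case
      using p by (simp only: e smooth_add smooth_mult smooth_const sb sp) simp
  qed
  have h: "mono_tensor h \<alpha> \<in> sym_fields k"
    by (rule mono_tensor_in_sym_fields[OF ph(2) assms(3)])
  have trace1: "trace (mat 1 :: real ^ 'm ^ 'm) = real CARD('m)"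
    by (simp add: trace_def mat_def)
  have eh: "mono_tensor (\<lambda>x. euler x0 h x + c * h x) \<alpha> \<in> sym_fields k" for c
    by (intro mono_tensor_in_sym_fields smooth_add smooth_mult smooth_const smooth_euler ph(2) assms(3))
  \<comment> \<open>At \<open>x0\<close> the Euler field acts on tensors of degree \<open>l\<close>
    by the scalar \<open>\<delta> m - l\<close>. Subtracting it from
    \<open>E + \<delta> m - k\<close>, the action on the coefficient \<open>h\<close>, leaves
    \<open>E + (l - k)\<close>.\<close>
  have q1: "V (mono_tensor (\<lambda>x. euler x0 h x + (\<delta> * real CARD('m) - real k) * h x) \<alpha>) x0 \<xi> =
      (\<delta> * real CARD('m) - real l) * V (mono_tensor h \<alpha>) x0 \<xi>"
    using V_affine[OF h, of x0 "mat 1" \<xi>] sym_fields_euler[OF V_in[OF h], of x0 \<xi>]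
    by (simp add: lie_tensor_euler_field[OF ph(2)] assms(3) transpose_mat trace1 algebra_simps)
  have q2: "mono_tensor (\<lambda>x. euler x0 h x + of_int (int l - int k) * h x) \<alpha> =
      mono_tensor (\<lambda>x. euler x0 h x + (\<delta> * real CARD('m) - real k) * h x) \<alpha>
      + (real l - \<delta> * real CARD('m)) *\<^sub>R mono_tensor h \<alpha>"
    by (simp add: mono_tensor_def fun_eq_iff algebra_simps)
  have "V (mono_tensor (\<lambda>x. euler x0 h x + of_int (int l - int k) * h x) \<alpha>) x0 \<xi> = 0"
    unfolding q2 V_add[OF eh sym_fields_scaleR[OF h]] V_scaleR[OF h] plus_fun_apply scaleR_fun_apply q1
    by (simp add: algebra_simps)
  moreover have "V (mono_tensor g \<alpha>) = V (mono_tensor p \<alpha>)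
      + V (mono_tensor (\<lambda>x. euler x0 h x + of_int (int l - int k) * h x) \<alpha>)"
    unfolding ph(3) add[of p "\<lambda>x. euler x0 h x + of_int (int l - int k) * h x"]
    by (rule V_add[OF mono_tensor_in_sym_fields eh]) (use p assms(3) in auto)
  ultimately show ?thesis using p by simp
qed

section \<open>Relations between the values of \<open>V\<close> on monomial tensors\<close>

lemma unit_field_relation:
  assumes "mdegree \<alpha> = k"
  shows "real (\<beta> i) * V (mono_at x0 (up j (down i \<beta>)) \<alpha>) x0 \<xi>
      - real (\<alpha> j) * V (mono_at x0 \<beta> (up i (down j \<alpha>))) x0 \<xi>
    = - (\<xi> $ i * pderivative j (V (mono_at x0 \<beta> \<alpha>) x0) \<xi>)"
proof -
  note M = mono_at_in_sym_fields[OF assms]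
  have 2: "- real (\<alpha> j) = 0 \<or> mono_at x0 \<beta> (up i (down j \<alpha>)) \<in> sym_fields k"
    using mdegree_up_down[of \<alpha> j i] by (cases "\<alpha> j = 0") (auto intro!: mono_at_in_sym_fields simp: assms)
  have "V (lie_tensor \<delta> (affine_field x0 (unit_matrix i j)) (mono_at x0 \<beta> \<alpha>)) =
      real (\<beta> i) *\<^sub>R V (mono_at x0 (up j (down i \<beta>)) \<alpha>)
    + (- real (\<alpha> j)) *\<^sub>R V (mono_at x0 \<beta> (up i (down j \<alpha>)))
    + (if i = j then \<delta> else 0) *\<^sub>R V (mono_at x0 \<beta> \<alpha>)"
    unfolding lie_tensor_unit_field
    by (simp only: V_add V_scaleR[OF M] V_scaled[OF 2] sym_fields_add sym_fields_scaleR M)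
  \<comment> \<open>The same Lie derivative is now taken after \<open>V\<close>; the divergence term
    agrees with the one above and cancels.\<close>
  moreover have "V (lie_tensor \<delta> (affine_field x0 (unit_matrix i j)) (mono_at x0 \<beta> \<alpha>)) x0 \<xi> =
      - (\<xi> $ i * pderivative j (V (mono_at x0 \<beta> \<alpha>) x0) \<xi>)
      + (if i = j then \<delta> else 0) * V (mono_at x0 \<beta> \<alpha>) x0 \<xi>"
    unfolding V_affine[OF M]
    by (simp add: transpose_unit_matrix unit_matrix_mult trace_unit_matrix
        frechet_derivative_axis[OF smooth_differentiable[OF sym_fields_smooth_fibre[OF V_in[OF M]]]])
  ultimately show ?thesis by simp
qed

text \<open>This comes from the diagonal field \<open>y_i \<partial>_i\<close>. At
  \<open>e_z\<close> its fibre action is 0 for \<open>i \<noteq> z\<close>, and for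
  \<open>i = z\<close> it is the Euler operator of the fibre, which gives the degree
  \<open>l\<close>.\<close>

lemma weight_relation:
  assumes "mdegree \<alpha> = k"
  shows "(real (\<beta> i) - real (\<alpha> i) + (if i = z then real l else 0)) * V (mono_at x0 \<beta> \<alpha>) x0 (axis z 1) = 0"
proof -
  note q = V_in[OF mono_at_in_sym_fields[OF assms, of x0 \<beta>]]
  have "real (\<beta> i) * V (mono_at x0 (up i (down i \<beta>)) \<alpha>) x0 (axis z 1) =
      real (\<beta> i) * V (mono_at x0 \<beta> \<alpha>) x0 (axis z 1)"
    by (cases "\<beta> i = 0") (simp_all add: up_down)
  moreover have "real (\<alpha> i) * V (mono_at x0 \<beta> (up i (down i \<alpha>))) x0 (axis z 1) =
      real (\<alpha> i) * V (mono_at x0 \<beta> \<alpha>) x0 (axis z 1)"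
    by (cases "\<alpha> i = 0") (simp_all add: up_down)
  moreover have "axis z 1 $ i * pderivative i (V (mono_at x0 \<beta> \<alpha>) x0) (axis z 1) =
      (if i = z then real l else 0) * V (mono_at x0 \<beta> \<alpha>) x0 (axis z 1)"
    using sym_fields_euler[OF q, of x0 "axis z 1"] by (simp add: pderivative_def axis_def)
  ultimately show ?thesis
    using unit_field_relation[OF assms, of \<beta> i x0 i "axis z 1"] by (simp only: ring_distribs)
qed

text \<open>The field is \<open>y_z \<partial>_i\<close>. Its fibre action carries the factor
  \<open>\<xi>_i\<close>, which is 0 at \<open>e_z\<close>.\<close>

lemma shift_relation:
  assumes "mdegree \<alpha> = k" "i \<noteq> z"
  shows "real (\<beta> i) * V (mono_at x0 (up z (down i \<beta>)) \<alpha>) x0 (axis z 1) =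
    real (\<alpha> z) * V (mono_at x0 \<beta> (up i (down z \<alpha>))) x0 (axis z 1)"
  using unit_field_relation[OF assms(1), of \<beta> i x0 z "axis z 1"] assms(2)
  by (simp add: axis_def)

lemma quadratic_relation:
  assumes "mdegree \<alpha> = k"
  shows "(real (mdegree \<beta>) - real k + (real CARD('m) + 1) * \<delta>) * V (mono_at x0 (up z \<beta>) \<alpha>) x0 \<xi> =
    real (\<alpha> z) * (\<Sum>i\<in>UNIV. V (mono_at x0 (up i \<beta>) (up i (down z \<alpha>))) x0 \<xi>)"
proof (cases "\<alpha> z = 0")
  \<comment> \<open>Here the tensors in the sum have degree \<open>k + 1\<close>, outside the domain
    of \<open>V\<close>; their coefficient is 0.\<close>
  case True
  then have "V (lie_tensor \<delta> (centred_quadratic_field x0 z) (mono_at x0 \<beta> \<alpha>)) =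
      (real (mdegree \<beta>) - real k + (real CARD('m) + 1) * \<delta>) *\<^sub>R V (mono_at x0 (up z \<beta>) \<alpha>)"
    unfolding lie_tensor_centred_quadratic_field
    by (simp only: assms of_nat_0 minus_zero scaleR_zero_left add_0_right V_scaleR[OF mono_at_in_sym_fields[OF assms]])
  then show ?thesis
    using V_quadratic[OF mono_at_in_sym_fields[OF assms, of x0 \<beta>], of x0 z \<xi>] True by simp
next
  case False
  let ?S = "\<Sum>i\<in>UNIV. mono_at x0 (up i \<beta>) (up i (down z \<alpha>))"
  have M: "mono_at x0 (up i \<beta>) (up i (down z \<alpha>)) \<in> sym_fields k" for i
    using mdegree_up_down[of \<alpha> z i] False by (intro mono_at_in_sym_fields) (simp add: assms)
  have S: "?S \<in> sym_fields k \<and> V ?S = (\<Sum>i\<in>UNIV. V (mono_at x0 (up i \<beta>) (up i (down z \<alpha>))))"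
    by (rule V_sum) (rule M)
  have sum_apply: "(\<Sum>i\<in>A. F i) x \<xi> = (\<Sum>i\<in>A. F i x \<xi>)" for A :: "'m set" and F :: "'m \<Rightarrow> 'm tensor_field" and x \<xi>
    by (induction A rule: infinite_finite_induct) auto
  have "V (lie_tensor \<delta> (centred_quadratic_field x0 z) (mono_at x0 \<beta> \<alpha>)) =
      (real (mdegree \<beta>) - real k + (real CARD('m) + 1) * \<delta>) *\<^sub>R V (mono_at x0 (up z \<beta>) \<alpha>)
      + (- real (\<alpha> z)) *\<^sub>R V ?S"
    unfolding lie_tensor_centred_quadratic_field
    by (simp only: assms V_add V_scaleR sym_fields_scaleR mono_at_in_sym_fields S)
  then show ?thesis
    using V_quadratic[OF mono_at_in_sym_fields[OF assms, of x0 \<beta>], of x0 z \<xi>]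
    by (simp only: S plus_fun_apply scaleR_fun_apply sum_apply real_scaleR_def)
qed

text \<open>The quadratic relation is applied to \<open>y_z^d \<xi>_z^k\<close> with
  \<open>d = k - l - 1\<close>, one factor \<open>y_z\<close> short of the target. In the sum on its
  right, direction \<open>z\<close> contributes \<open>k v\<close> and each of the other
  \<open>m - 1\<close> directions contributes \<open>v\<close>. Hence the factor of \<open>v\<close>
  is \<open>d - k + (m + 1) \<delta> - k - (m - 1) = (m + 1) \<delta> - m - (k + l)\<close>.\<close>

lemma highest_weight_value:
  assumes "l < k" "(real CARD('m) + 1) * \<delta> - real CARD('m) \<noteq> real (k + l)"
  shows "V (mono_at x0 (single z (k - l)) (single z k)) x0 (axis z 1) = 0"
proof -
  define d where "d = k - l - 1"
  define \<alpha> where "\<alpha> = single z k"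
  define \<beta> where "\<beta> = single z d"
  define v where "v = V (mono_at x0 (up z \<beta>) \<alpha>) x0 (axis z 1)"
  have d: "real d = real k - real l - 1" "k - l = Suc d" using assms(1) by (auto simp: d_def)
  have \<alpha>: "mdegree \<alpha> = k" "\<alpha> z = k" by (simp_all add: \<alpha>_def mdegree_single)
  have \<beta>: "mdegree \<beta> = d" "\<beta> z = d" by (simp_all add: \<beta>_def mdegree_single)
  have up\<beta>: "up z \<beta> = single z (k - l)" by (auto simp: \<beta>_def d(2))
  \<comment> \<open>The shift relation trades the single factor \<open>y_i\<close>, together with
    \<open>\<xi>_i\<close>, for \<open>y_z\<close> and \<open>\<xi>_z\<close>.\<close>
  have off: "real k * V (mono_at x0 (up i \<beta>) (up i (down z \<alpha>))) x0 (axis z 1) = v" if "i \<noteq> z" for i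
  proof -
    have "\<beta> i = 0" using that by (simp add: \<beta>_def)
    then have 1: "down i (up i \<beta>) = \<beta>" and 2: "real ((up i \<beta>) i) = 1" by auto
    show ?thesis
      using shift_relation[OF \<alpha>(1) that, of "up i \<beta>" x0] unfolding 1 2 \<alpha>(2) v_def by (simp only: mult_1)
  qed
  have diag: "real k * V (mono_at x0 (up z \<beta>) (up z (down z \<alpha>))) x0 (axis z 1) = real k * v"
    using assms(1) up_down[of \<alpha> z] by (simp add: \<alpha>(2) v_def)
  have "(real d - real k + (real CARD('m) + 1) * \<delta>) * v =
      (\<Sum>i\<in>UNIV. real k * V (mono_at x0 (up i \<beta>) (up i (down z \<alpha>))) x0 (axis z 1))"
    using quadratic_relation[OF \<alpha>(1), of \<beta> x0 z "axis z 1"]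
    by (simp only: \<beta>(1) \<alpha>(2) v_def sum_distrib_left)
  also have "\<dots> = real k * v + (\<Sum>i\<in>UNIV - {z}. v)"
    using off diag by (subst sum.remove[of _ z]) auto
  also have "(\<Sum>i\<in>UNIV - {z}. v) = (real CARD('m) - 1) * v"
    by (simp add: card_Diff_singleton of_nat_diff)
  finally have "((real CARD('m) + 1) * \<delta> - real CARD('m) - real (k + l)) * v = 0"
    by (simp add: d(1) algebra_simps)
  with assms(2) have "v = 0" by simp
  then show ?thesis by (simp only: v_def up\<beta> \<alpha>_def)
qed

text \<open>Where the value is nonzero, the weights make \<open>\<alpha>\<close> and
  \<open>\<beta>\<close> agree off \<open>z\<close>, so a factor \<open>y_i\<close> with
  \<open>i \<noteq> z\<close> is accompanied by \<open>\<xi>_i\<close>. The shift relation replaces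
  both by \<open>y_z\<close> and \<open>\<xi>_z\<close> at the cost of the nonzero factor
  \<open>\<alpha>_z + 1\<close>, and lowers the degree of \<open>y^\<beta>\<close> off
  \<open>z\<close>, on which the induction runs. The only tensor left is
  \<open>y_z^(k-l) \<xi>_z^k\<close>, and \<open>l \<le> k\<close> is then forced by
  \<open>\<alpha>_z = \<beta>_z + l\<close>.\<close>

lemma vanish_on_monomials:
  assumes "l = k \<Longrightarrow> V (mono_at x0 (\<lambda>_. 0) (single z k)) x0 (axis z 1) = 0"
    and "l \<noteq> k \<Longrightarrow> (real CARD('m) + 1) * \<delta> - real CARD('m) \<noteq> real (k + l)"
    and "mdegree \<alpha> = k"
  shows "V (mono_at x0 \<beta> \<alpha>) x0 (axis z 1) = 0"
  using assms(3)
proof (induction "sum \<beta> (UNIV - {z})" arbitrary: \<beta> \<alpha> rule: less_induct)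
  case less
  show ?case
  proof (rule ccontr)
    assume nz: "V (mono_at x0 \<beta> \<alpha>) x0 (axis z 1) \<noteq> 0"
    have w: "real (\<beta> i) - real (\<alpha> i) + (if i = z then real l else 0) = 0" for i
      using weight_relation[OF less.prems, of \<beta> i z x0] nz by simp
    have wi: "\<alpha> i = \<beta> i" if "i \<noteq> z" for i using w[of i] that by simp
    have wz: "\<alpha> z = \<beta> z + l" using w[of z] by simp
    show False
    proof (cases "\<forall>i. i \<noteq> z \<longrightarrow> \<beta> i = 0")
      case True
      then have \<alpha>: "\<alpha> = single z (\<alpha> z)" using wi by (auto simp: fun_eq_iff)
      then have k: "\<alpha> z = k" using less.prems mdegree_single[of z "\<alpha> z"] by simp
      have \<beta>: "\<beta> = single z (k - l)" using True wz k by (auto simp: fun_eq_iff)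
      have "l \<le> k" using wz k by simp
      have "V (mono_at x0 (single z (k - l)) (single z k)) x0 (axis z 1) = 0"
      proof (cases "l = k")
        case True
        then have "single z (k - l) = (\<lambda>_. 0)" by auto
        with assms(1)[OF True] show ?thesis by simp
      next
        case False
        with \<open>l \<le> k\<close> show ?thesis by (intro highest_weight_value assms(2)) auto
      qed
      moreover have "\<alpha> = single z k" using True wi k by (auto simp: fun_eq_iff)
      ultimately show False using nz \<beta> by (simp only: simp_thms)
    next
      case False
      then obtain i where i: "i \<noteq> z" "\<beta> i > 0" by auto
      define \<alpha>' where "\<alpha>' = up z (down i \<alpha>)"
      have "\<alpha> i > 0" using i wi by simp
      then have \<alpha>': "mdegree \<alpha>' = k"
        unfolding \<alpha>'_def less.prems[symmetric] by (rule mdegree_up_down)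
      have \<alpha>'_down: "up i (down z \<alpha>') = \<alpha>" "\<alpha>' z = Suc (\<alpha> z)"
        using i \<open>0 < \<alpha> i\<close> by (auto simp: \<alpha>'_def fun_eq_iff)
      have "sum (up z (down i \<beta>)) (UNIV - {z}) < sum \<beta> (UNIV - {z})"
        by (rule sum_strict_mono_ex1) (use i in auto)
      from less.hyps[OF this \<alpha>'] have "V (mono_at x0 (up z (down i \<beta>)) \<alpha>') x0 (axis z 1) = 0" .
      then have "real (\<alpha>' z) * V (mono_at x0 \<beta> \<alpha>) x0 (axis z 1) = 0"
        using shift_relation[OF \<alpha>' i(1), of \<beta> x0] unfolding \<alpha>'_down(1) by (simp only: mult_zero_right)
      then show False using nz by (simp only: \<alpha>'_down(2) mult_eq_0_iff) simp
    qed
  qed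
qed

section \<open>From monomial tensors to all tensors, covectors and points\<close>

lemma vanish_on_sym_fields:
  assumes "\<And>\<beta> \<alpha>. mdegree \<alpha> = k \<Longrightarrow> V (mono_at x0 \<beta> \<alpha>) x0 \<xi> = 0" "P \<in> sym_fields k"
  shows "V P x0 \<xi> = 0"
proof -
  obtain a where a: "\<And>\<alpha>. smooth (a \<alpha>)" "P = poly_field k a" by (rule sym_fieldsE[OF assms(2)]) (rule that)
  have sum: "V P = (\<Sum>\<alpha> | mdegree \<alpha> = k. V (mono_tensor (a \<alpha>) \<alpha>))"
    unfolding a(2) poly_field_eq_sum
    by (rule V_sum[THEN conjunct2]) (auto intro: mono_tensor_in_sym_fields a)
  have "(\<Sum>\<alpha>\<in>S. V (mono_tensor (a \<alpha>) \<alpha>)) x0 \<xi> = 0" if "\<And>\<alpha>. \<alpha> \<in> S \<Longrightarrow> mdegree \<alpha> = k" for S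
    using that
    by (induction S rule: infinite_finite_induct)
      (auto intro: vanish_on_smooth_coefficients assms(1) a)
  from this[of "{\<alpha>. mdegree \<alpha> = k}"] show ?thesis
    unfolding sum by (simp only: mem_Collect_eq)
qed

text \<open>Along the line \<open>e\<^sub>z + t w\<close> the linear field \<open>X = (w \<bullet> y) \<partial>\<^sub>z\<close> turns the derivative of \<open>V P x0\<close> into
  \<open>- V (L\<^sub>X P) x0\<close>, so all derivatives in \<open>t\<close> vanish at \<open>t = 0\<close>.\<close>

lemma vanish_along_line:
  assumes "\<And>P. P \<in> sym_fields k \<Longrightarrow> V P x0 (axis z 1) = 0" "w $ z = 0"
    and "P \<in> sym_fields k" "\<forall>t. V P x0 (axis z 1 + t *\<^sub>R w) = poly p t" "degree p \<le> n"
  shows "p = 0"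
  using assms(3-)
proof (induction n arbitrary: P p)
  case 0
  then obtain c where p: "p = [:c:]" by (auto elim: degree_eq_zeroE)
  from 0(2)[rule_format, of 0] assms(1)[OF 0(1)] show ?case by (simp add: p)
next
  case (Suc n)
  \<comment> \<open>This is the matrix of the field \<open>X\<close>. Because
    \<open>w $ z = 0\<close>, the component \<open>\<xi>_z\<close> is 1 all along the line, so the
    fibre action of \<open>X\<close> differentiates exactly in direction \<open>w\<close>; for the
    same reason the trace is 0 and no divergence term appears.\<close>
  define A where "A = (\<chi> r s. if r = z then w $ s else 0)"
  define Q where "Q = lie_tensor \<delta> (affine_field x0 A) P"
  have tA: "transpose A *v \<xi> = (\<xi> $ z) *\<^sub>R w" for \<xi>
    by (simp add: A_def transpose_def vec_eq_iff matrix_vector_mult_def if_zero_mult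
        del: transpose_matrix_vector)
  have trA: "trace A = 0" by (simp add: A_def trace_def assms(2))
  have Q: "Q \<in> sym_fields k" unfolding Q_def by (intro lie_in affine_field_sl Suc.prems)
  obtain q where q: "\<forall>t. V Q x0 (axis z 1 + t *\<^sub>R w) = poly q t"
    using sym_fields_along_line[OF V_in[OF Q]] by blast
  have "poly (pderiv p) t = - poly q t" for t
  proof -
    let ?\<xi> = "axis z 1 + t *\<^sub>R w"
    have "((\<lambda>t. axis z 1 + t *\<^sub>R w) has_derivative (\<lambda>h. h *\<^sub>R w)) (at t)"
      by (auto intro!: derivative_eq_intros)
    from has_derivative_compose[OF this smooth_has_frechet_derivative[OF sym_fields_smooth_fibre[OF V_in[OF Suc.prems(1)], of x0]]]
    have d1: "((\<lambda>t. poly p t) has_derivative (\<lambda>h. frechet_derivative (V P x0) (at ?\<xi>) (h *\<^sub>R w))) (at t)"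
      using Suc.prems(2) by simp
    have d2: "((\<lambda>t. poly p t) has_derivative (\<lambda>h. poly (pderiv p) t * h)) (at t)"
      using poly_DERIV[of p t] by (simp add: has_field_derivative_def)
    have "frechet_derivative (V P x0) (at ?\<xi>) (1 *\<^sub>R w) = poly (pderiv p) t * 1"
      using fun_cong[OF has_derivative_unique[OF d1 d2], of 1] .
    moreover have "poly q t = - frechet_derivative (V P x0) (at ?\<xi>) w"
      using q[rule_format, of t] assms(2)
      by (simp add: Q_def V_affine[OF Suc.prems(1)] tA trA del: transpose_matrix_vector)
    ultimately show ?thesis by simp
  qed
  then have pq: "pderiv p = - q" by (intro poly_eqI_degree_lead_coeff poly_ext) simp
  have "degree q \<le> n"
    using degree_pderiv[of p] Suc.prems(3) by (simp add: pq)
  from Suc.IH[OF Q q this] have "pderiv p = 0" using pq by simp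
  then have "degree p = 0" by (simp add: pderiv_eq_0_iff)
  then obtain c where p: "p = [:c:]" by (auto elim: degree_eq_zeroE)
  from Suc.prems(2)[rule_format, of 0] assms(1)[OF Suc.prems(1)] show ?case by (simp add: p)
qed

text \<open>If \<open>\<xi>_z \<noteq> 0\<close>, then \<open>\<xi>\<close> is a multiple of some
  \<open>e_z + w\<close> with \<open>w_z = 0\<close>, and homogeneity applies. Any other
  \<open>\<xi>\<close> lies on a line in direction \<open>e_z\<close>, on which the value is a
  polynomial in \<open>t\<close> with infinitely many zeros.\<close>

lemma vanish_on_covectors:
  assumes "\<And>P. P \<in> sym_fields k \<Longrightarrow> V P x0 (axis z 1) = 0" "P \<in> sym_fields k"
  shows "V P x0 \<xi> = 0"
proof -
  have nonzero: "V P x0 \<xi> = 0" if "\<xi> $ z \<noteq> 0" for \<xi>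
  proof -
    define w where "w = (1 / \<xi> $ z) *\<^sub>R \<xi> - axis z 1"
    have w: "w $ z = 0" using that by (simp add: w_def axis_def)
    obtain p where p: "\<forall>t. V P x0 (axis z 1 + t *\<^sub>R w) = poly p t"
      using sym_fields_along_line[OF V_in[OF assms(2)]] by blast
    from vanish_along_line[OF assms(1) w assms(2) p order_refl]
    have "V P x0 (axis z 1 + 1 *\<^sub>R w) = 0" using p[rule_format, of 1] by simp
    moreover have "\<xi> = (\<xi> $ z) *\<^sub>R (axis z 1 + 1 *\<^sub>R w)" using that by (simp add: w_def)
    ultimately show ?thesis
      using sym_fields_homogeneous[OF V_in[OF assms(2)], of x0 "\<xi> $ z" "axis z 1 + 1 *\<^sub>R w"] by simp
  qed
  obtain p where p: "\<forall>t. V P x0 (\<xi> + t *\<^sub>R axis z 1) = poly p t"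
    using sym_fields_along_line[OF V_in[OF assms(2)]] by blast
  have "{t. t \<noteq> - (\<xi> $ z)} \<subseteq> {t. poly p t = 0}"
  proof safe
    fix t assume "t \<noteq> - (\<xi> $ z)"
    then have "(\<xi> + t *\<^sub>R axis z 1) $ z \<noteq> 0" by (simp add: axis_def)
    from nonzero[OF this] show "poly p t = 0" using p[rule_format, of t] by simp
  qed
  moreover have "infinite {t :: real. t \<noteq> - (\<xi> $ z)}"
    using infinite_UNIV_char_0[where 'a = real] by (simp add: Compl_eq[symmetric] Collect_neg_eq)
  ultimately have "infinite {t. poly p t = 0}" using infinite_super by blast
  then have "p = 0" using poly_roots_finite[of p] by blast
  with p[rule_format, of 0] show ?thesis by simp
qed

text \<open>A tensor with constant coefficients is annihilated by the constant fields, hence so is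
  its image, all of whose partial derivatives in \<open>x\<close> vanish. This allows the scalar
  \<open>a k\<close> to be read off at the origin alone.\<close>

lemma constant_image:
  assumes "mdegree \<alpha> = k"
  shows "V (mono_tensor (\<lambda>_. 1) \<alpha>) x \<xi> = V (mono_tensor (\<lambda>_. 1) \<alpha>) 0 \<xi>"
proof -
  let ?C = "mono_tensor (\<lambda>_. 1) \<alpha>"
  note C = mono_tensor_in_sym_fields[OF smooth_const[of 1] assms]
  have der: "(const_field i has_derivative (*v) 0) (at y)" for i :: 'm and y
    unfolding const_field_def matrix_vector_mult_0 by (rule has_derivative_const)
  have lie: "lie_tensor \<delta> (const_field i) Q y \<eta> = pderivative i (\<lambda>y. Q y \<eta>) y" if "Q \<in> sym_fields n"
    for i :: 'm and Q y \<eta> and n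
  proof -
    have "frechet_derivative (Q y) (at \<eta>) 0 = 0"
      by (intro linear_0 linear_frechet_derivative smooth_differentiable sym_fields_smooth_fibre[OF that])
    moreover have "transpose (0 :: real ^ 'm ^ 'm) *v \<eta> = 0"
      by (simp add: transpose_def vec_eq_iff matrix_vector_mult_def del: transpose_matrix_vector)
    moreover have "deriv_along (const_field i) (\<lambda>y. Q y \<eta>) y = pderivative i (\<lambda>y. Q y \<eta>) y"
      by (simp add: deriv_along_eq smooth_differentiable[OF sym_fields_smooth[OF that]]
          const_field_def pderivative_def)
    ultimately show ?thesis
      by (simp add: lie_tensor_def jacobianI[OF der] rho_def trace_def del: transpose_matrix_vector)
  qed
  have "lie_tensor \<delta> (const_field i) ?C = 0" for i
    by (intro ext) (simp only: lie[OF C], simp add: mono_tensor_def pderivative_const)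
  then have "lie_tensor \<delta> (const_field i) (V ?C) = 0" for i
    using V_lie[OF const_field_sl C, of i] V_zero by (simp only:)
  then have "pderivative i (\<lambda>y. V ?C y \<xi>) y = 0" for i y
    using lie[OF V_in[OF C], of i y \<xi>] by simp
  then have "((\<lambda>y. V ?C y \<xi>) has_derivative (\<lambda>h. 0)) (at y within UNIV)" for y
    using has_derivative_pderivative[OF smooth_differentiable[OF sym_fields_smooth[OF V_in[OF C]]], of \<xi> y] by simp
  from has_derivative_zero_unique[OF convex_UNIV this]
  show ?thesis by blast
qed

text \<open>For \<open>l = k\<close> a single number decides: the value at the origin and
  \<open>e_z\<close> of the image of \<open>\<xi>_z^k\<close>.\<close>

theorem vanishes:
  assumes "l = k \<Longrightarrow> V (mono_tensor (\<lambda>_. 1) (single z k)) 0 (axis z 1) = 0"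
    and "l \<noteq> k \<Longrightarrow> (real CARD('m) + 1) * \<delta> - real CARD('m) \<noteq> real (k + l)"
    and "P \<in> sym_fields k"
  shows "V P = 0"
proof -
  have "V P x0 \<xi> = 0" for x0 \<xi>
  proof (rule vanish_on_covectors[OF vanish_on_sym_fields[OF vanish_on_monomials]])
    have "mono_at x0 (\<lambda>_. 0) (single z k) = mono_tensor (\<lambda>_. 1) (single z k)"
      by (simp add: mono_at_def monomial_def)
    then show "V (mono_at x0 (\<lambda>_. 0) (single z k)) x0 (axis z 1) = 0" if "l = k"
      using assms(1)[OF that] constant_image[OF mdegree_single[of z k], of x0 "axis z 1"] by simp
  qed (use assms in auto)
  then show ?thesis by (simp add: fun_eq_iff)
qed

end

section \<open>Symbol maps\<close>

lemma homogeneous_in_symbols: "P \<in> sym_fields k \<Longrightarrow> homogeneous k P \<in> symbols"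
  unfolding symbols_def homogeneous_def
  by (auto simp: sym_fields_zero intro: finite_subset[of _ "{k}"])

lemma homogeneous_add: "homogeneous k (P + Q) = homogeneous k P + homogeneous k Q"
  by (auto simp: homogeneous_def fun_eq_iff)

lemma homogeneous_scaleR: "homogeneous k (c *\<^sub>R P) = c *\<^sub>R homogeneous k P"
  by (auto simp: homogeneous_def fun_eq_iff)

lemma lie_symbol_homogeneous: "lie_symbol \<delta> X (homogeneous k P) = homogeneous k (lie_tensor \<delta> X P)"
  by (rule ext) (simp add: lie_symbol_def homogeneous_def lie_tensor_zero)

lemma symbols_add:
  assumes "s \<in> symbols" "t \<in> symbols"
  shows "s + t \<in> symbols"
proof -
  have "{k. (s + t) k \<noteq> 0} \<subseteq> {k. s k \<noteq> 0} \<union> {k. t k \<noteq> 0}" by auto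
  then have "finite {k. (s + t) k \<noteq> 0}"
    by (rule finite_subset) (use assms in \<open>simp add: symbols_def\<close>)
  moreover have "(s + t) k \<in> sym_fields k" for k
    unfolding plus_fun_apply[of s t k] using assms by (intro sym_fields_add) (simp_all add: symbols_def)
  ultimately show ?thesis by (simp only: symbols_def mem_Collect_eq) simp
qed

lemma
  assumes "linear_map_on V T"
  shows linear_map_on_add: "u \<in> V \<Longrightarrow> v \<in> V \<Longrightarrow> T (u + v) = T u + T v"
    and linear_map_on_scaleR: "u \<in> V \<Longrightarrow> T (c *\<^sub>R u) = c *\<^sub>R T u"
  using assms unfolding linear_map_on_def by simp_all

locale symbol_map =
  fixes lam mu \<delta> :: real and \<sigma> :: "'m::finite operator \<Rightarrow> 'm symbol"
  assumes symbol_map: "sl_symbol_map lam mu \<sigma>" and weight: "mu - lam = \<delta>"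
begin

abbreviation inv_symbol :: "'m symbol \<Rightarrow> 'm operator"
  where "inv_symbol \<equiv> inv_into diffops \<sigma>"

lemma
  shows linear_symbol: "linear_map_on diffops \<sigma>"
    and bij_symbol: "bij_betw \<sigma> diffops symbols"
    and symbol_lie: "\<And>X A. X \<in> sl_fields \<Longrightarrow> A \<in> diffops \<Longrightarrow>
      \<sigma> (lie_operator lam mu X A) = lie_symbol \<delta> X (\<sigma> A)"
  using symbol_map unfolding sl_symbol_map_def weight by simp_all

lemma symbol_in: "A \<in> diffops \<Longrightarrow> \<sigma> A \<in> symbols"
  by (rule bij_betw_apply[OF bij_symbol])

lemma symbol_inj: "A \<in> diffops \<Longrightarrow> B \<in> diffops \<Longrightarrow> \<sigma> A = \<sigma> B \<Longrightarrow> A = B"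
  by (rule inj_onD[OF bij_betw_imp_inj_on[OF bij_symbol]])

lemma inv_symbol_in: "s \<in> symbols \<Longrightarrow> inv_symbol s \<in> diffops"
  by (rule bij_betw_apply[OF bij_betw_inv_into[OF bij_symbol]])

lemma symbol_inv_symbol: "s \<in> symbols \<Longrightarrow> \<sigma> (inv_symbol s) = s"
  by (rule bij_betw_inv_into_right[OF bij_symbol])

lemma inv_symbol_symbol: "A \<in> diffops \<Longrightarrow> inv_symbol (\<sigma> A) = A"
  by (rule bij_betw_inv_into_left[OF bij_symbol])

lemma symbol_add: "A \<in> diffops \<Longrightarrow> B \<in> diffops \<Longrightarrow> \<sigma> (A + B) = \<sigma> A + \<sigma> B"
  by (rule linear_map_on_add[OF linear_symbol])

lemma symbol_scaleR: "A \<in> diffops \<Longrightarrow> \<sigma> (c *\<^sub>R A) = c *\<^sub>R \<sigma> A"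
  by (rule linear_map_on_scaleR[OF linear_symbol])

lemma inv_symbol_add:
  assumes "s \<in> symbols" "t \<in> symbols"
  shows "inv_symbol (s + t) = inv_symbol s + inv_symbol t"
  by (rule symbol_inj)
    (simp_all only: inv_symbol_in symbols_add assms add_in_diffops symbol_add symbol_inv_symbol)

lemma inv_symbol_scaleR:
  assumes "s \<in> symbols"
  shows "inv_symbol (c *\<^sub>R s) = c *\<^sub>R inv_symbol s"
proof -
  have "\<sigma> (c *\<^sub>R inv_symbol s) = c *\<^sub>R s"
    by (simp only: symbol_scaleR inv_symbol_in assms symbol_inv_symbol)
  then show ?thesis
    using inv_symbol_symbol[OF scaleR_in_diffops[OF inv_symbol_in[OF assms]], of c] by (simp only:)
qed

lemma lie_in_diffops: "X \<in> sl_fields \<Longrightarrow> A \<in> diffops \<Longrightarrow> lie_operator lam mu X A \<in> diffops"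
  by (intro lie_operator_in_diffops smooth_field_sl)

lemma inv_symbol_lie:
  assumes "X \<in> sl_fields" "s \<in> symbols"
  shows "inv_symbol (lie_symbol \<delta> X s) = lie_operator lam mu X (inv_symbol s)"
proof -
  have "\<sigma> (lie_operator lam mu X (inv_symbol s)) = lie_symbol \<delta> X s"
    by (simp only: symbol_lie assms inv_symbol_in symbol_inv_symbol)
  then show ?thesis
    using inv_symbol_symbol[OF lie_in_diffops[OF assms(1) inv_symbol_in[OF assms(2)]]] by (simp only:)
qed

text \<open>Coefficients need not be computed. \<open>P\<close> is the symbol of some operator,
  whose Lie derivative is again a differential operator, and the symbol of that one is the Lie
  derivative of \<open>P\<close>, placed in degree \<open>k\<close>.\<close>

lemma lie_tensor_in_sym_fields:
  fixes P :: "'m tensor_field"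
  assumes "X \<in> sl_fields" "P \<in> sym_fields k"
  shows "lie_tensor \<delta> X P \<in> sym_fields k"
proof -
  let ?A = "inv_symbol (homogeneous k P)"
  have "\<sigma> (lie_operator lam mu X ?A) \<in> symbols"
    by (intro symbol_in lie_in_diffops inv_symbol_in homogeneous_in_symbols assms)
  then have "homogeneous k (lie_tensor \<delta> X P) \<in> symbols"
    by (simp only: symbol_lie assms inv_symbol_in homogeneous_in_symbols symbol_inv_symbol
        lie_symbol_homogeneous)
  then show ?thesis unfolding symbols_def homogeneous_def by (auto dest: spec[of _ k])
qed

end

theorem proposition8p8:
  fixes lam mu lam' mu' \<delta> :: real
    and \<sigma> \<sigma>' :: "'m::finite operator \<Rightarrow> 'm symbol"
    and T :: "'m operator \<Rightarrow> 'm operator"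
  assumes "mu - lam = \<delta>" and "mu' - lam' = \<delta>"
    and "\<forall>n::nat. n \<ge> 1 \<longrightarrow> (real CARD('m) + 1) * \<delta> - real CARD('m) \<noteq> real n"
    and "sl_symbol_map lam mu \<sigma>" and "sl_symbol_map lam' mu' \<sigma>'"
    and "T \<in> diffops \<rightarrow> diffops" and "linear_map_on diffops T"
  shows "sl_equivariant_op lam mu lam' mu' T \<longleftrightarrow>
    (\<exists>a :: nat \<Rightarrow> real. \<forall>k. \<forall>P\<in>sym_fields k.
      \<sigma>' (T (inv_into diffops \<sigma> (homogeneous k P))) = a k *\<^sub>R homogeneous k P)"
proof -
  interpret S: symbol_map lam mu \<delta> \<sigma> by unfold_locales (fact assms)+
  interpret S': symbol_map lam' mu' \<delta> \<sigma>' by unfold_locales (fact assms)+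
  define G where "G = (\<lambda>s. \<sigma>' (T (inv_into diffops \<sigma> s)))"
  have T_in: "T A \<in> diffops" if "A \<in> diffops" for A using assms(6) that by auto
  have T_add: "T (A + B) = T A + T B" if "A \<in> diffops" "B \<in> diffops" for A B
    by (rule linear_map_on_add[OF assms(7) that])
  have T_scaleR: "T (c *\<^sub>R A) = c *\<^sub>R T A" if "A \<in> diffops" for A c
    by (rule linear_map_on_scaleR[OF assms(7) that])
  have G_in: "G s \<in> symbols" if "s \<in> symbols" for s
    unfolding G_def by (intro S'.symbol_in T_in S.inv_symbol_in that)
  have G_add: "G (s + t) = G s + G t" if "s \<in> symbols" "t \<in> symbols" for s t
    by (simp only: G_def S.inv_symbol_add that T_add S.inv_symbol_in S'.symbol_add T_in)
  have G_scaleR: "G (c *\<^sub>R s) = c *\<^sub>R G s" if "s \<in> symbols" for s c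
    by (simp only: G_def S.inv_symbol_scaleR that T_scaleR S.inv_symbol_in S'.symbol_scaleR T_in)
  have "sl_equivariant_op lam mu lam' mu' T \<longleftrightarrow>
    (\<exists>a :: nat \<Rightarrow> real. \<forall>k. \<forall>P\<in>sym_fields k. G (homogeneous k P) = a k *\<^sub>R homogeneous k P)"
  proof
    assume T: "sl_equivariant_op lam mu lam' mu' T"
    have G_lie: "G (lie_symbol \<delta> X s) = lie_symbol \<delta> X (G s)" if "X \<in> sl_fields" "s \<in> symbols" for X s
    proof -
      have "T (lie_operator lam mu X (S.inv_symbol s)) = lie_operator lam' mu' X (T (S.inv_symbol s))"
        using T that S.inv_symbol_in unfolding sl_equivariant_op_def by blast
      then show ?thesis
        by (simp only: G_def S.inv_symbol_lie that S'.symbol_lie T_in S.inv_symbol_in)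
    qed
    define U where "U = (\<lambda>k l P. G (homogeneous k P) l)"
    have U: "equivariant_map (U k l) k l \<delta>" for k l
    proof
      fix P Q :: "'m tensor_field" and c and X :: "'m vector_field"
      assume P: "P \<in> sym_fields k"
      note h = homogeneous_in_symbols[OF P]
      show "U k l P \<in> sym_fields l"
        using G_in[OF h] by (simp add: U_def symbols_def)
      show "U k l (c *\<^sub>R P) = c *\<^sub>R U k l P"
        by (simp only: U_def homogeneous_scaleR G_scaleR[OF h] scaleR_fun_apply)
      show "U k l (P + Q) = U k l P + U k l Q" if "Q \<in> sym_fields k"
        by (simp only: U_def homogeneous_add G_add[OF h homogeneous_in_symbols[OF that]] plus_fun_apply)
      assume X: "X \<in> sl_fields"
      show "lie_tensor \<delta> X P \<in> sym_fields k"
        by (rule S.lie_tensor_in_sym_fields[OF X P])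
      show "U k l (lie_tensor \<delta> X P) = lie_tensor \<delta> X (U k l P)"
        unfolding U_def lie_symbol_homogeneous[symmetric] G_lie[OF X h] by (simp only: lie_symbol_def)
    qed
    \<comment> \<open>Any index will do.\<close>
    define z :: 'm where "z = undefined"
    define C where "C = (\<lambda>k. mono_tensor (\<lambda>_. 1) (single z k))"
    have C: "C k \<in> sym_fields k" "C k x (axis z 1) = 1" for k x
      unfolding C_def
      by (intro mono_tensor_in_sym_fields smooth_const mdegree_single)
        (simp add: mono_tensor_def monomial_single)
    \<comment> \<open>Evaluation at \<open>e_z\<close> extracts the coefficient of
      \<open>\<xi>_z^k\<close>: \<open>a k\<close> is the one that the image of
      \<open>\<xi>_z^k\<close> has at the origin.\<close>
    define a where "a = (\<lambda>k. U k k (C k) 0 (axis z 1))"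
    have off: "U k l P = 0" if "P \<in> sym_fields k" "l \<noteq> k" for k l P
    proof (rule equivariant_map.vanishes[OF U _ _ that(1)])
      \<comment> \<open>Distinct degrees have a positive sum, so the resonances \<open>k + l\<close>
        are among the excluded values 1, 2, 3, and so on.\<close>
      have "1 \<le> k + l" using that(2) by simp
      then show "(real CARD('m) + 1) * \<delta> - real CARD('m) \<noteq> real (k + l)"
        using assms(3) by blast
    qed (use that in simp)
    have diag: "U k k P = a k *\<^sub>R P" if P: "P \<in> sym_fields k" for k P
    proof -
      interpret U: equivariant_map "U k k" k k \<delta> by (rule U)
      \<comment> \<open>Subtracting a scalar keeps equivariance, and \<open>a k\<close> is chosen so
        that the deciding value of \<open>V\<close> is 0.\<close>
      define V where "V = (\<lambda>P. U k k P + (- a k) *\<^sub>R P)"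
      have "equivariant_map V k k \<delta>"
      proof
        fix P Q :: "'m tensor_field" and c and X :: "'m vector_field"
        assume P: "P \<in> sym_fields k"
        show "V P \<in> sym_fields k"
          unfolding V_def by (intro sym_fields_add sym_fields_scaleR U.V_in P)
        show "V (c *\<^sub>R P) = c *\<^sub>R V P"
          by (simp add: V_def U.V_scaleR[OF P] fun_eq_iff algebra_simps)
        show "V (P + Q) = V P + V Q" if "Q \<in> sym_fields k"
          by (simp add: V_def U.V_add[OF P that] fun_eq_iff algebra_simps)
        assume X: "X \<in> sl_fields"
        show "lie_tensor \<delta> X P \<in> sym_fields k"
          by (rule U.lie_in[OF X P])
        show "V (lie_tensor \<delta> X P) = lie_tensor \<delta> X (V P)"
          by (simp only: V_def U.V_lie[OF X P] lie_tensor_scaleR[OF P]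
              lie_tensor_add[OF U.V_in[OF P] sym_fields_scaleR[OF P]])
      qed
      then have "V P = 0"
      proof (rule equivariant_map.vanishes[OF _ _ _ P])
        have "V (C k) 0 (axis z 1) = 0" using C(2)[of k 0] by (simp add: V_def a_def)
        then show "V (mono_tensor (\<lambda>_. 1) (single z k)) 0 (axis z 1) = 0" by (simp add: C_def)
      qed simp
      then show ?thesis by (simp add: V_def fun_eq_iff)
    qed
    have "G (homogeneous k P) = a k *\<^sub>R homogeneous k P" if P: "P \<in> sym_fields k" for k P
    proof
      fix l
      show "G (homogeneous k P) l = (a k *\<^sub>R homogeneous k P) l"
        using off[OF P, of l] diag[OF P] by (cases "l = k") (simp_all add: U_def homogeneous_def)
    qed
    then show "\<exists>a. \<forall>k. \<forall>P\<in>sym_fields k. G (homogeneous k P) = a k *\<^sub>R homogeneous k P"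
      by blast
  next
    assume "\<exists>a. \<forall>k. \<forall>P\<in>sym_fields k. G (homogeneous k P) = a k *\<^sub>R homogeneous k P"
    then obtain a where a: "G (homogeneous k P) = a k *\<^sub>R homogeneous k P" if "P \<in> sym_fields k" for k P
      by blast
    have G: "G s = (\<lambda>k. a k *\<^sub>R s k)" if s: "s \<in> symbols" for s
    proof -
      \<comment> \<open>\<open>G\<close> is known on homogeneous symbols only, and additivity
        reaches finite sums. The induction truncates \<open>s\<close> to a finite set of degrees,
        finally to its support.\<close>
      have part: "(\<lambda>k. if k \<in> F then s k else 0) \<in> symbols \<and>
          G (\<lambda>k. if k \<in> F then s k else 0) = (\<lambda>k. if k \<in> F then a k *\<^sub>R s k else 0)"
        if "finite F" for F
        using that
      proof (induction F)
        case empty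
        \<comment> \<open>The zero symbol is written as a homogeneous one so that the hypothesis on
          \<open>G\<close> covers it.\<close>
        have z: "(\<lambda>k. if k \<in> {} then s k else 0) = homogeneous 0 0"
          by (auto simp: homogeneous_def)
        have "G (homogeneous 0 0) = a 0 *\<^sub>R homogeneous 0 0" by (rule a) (rule sym_fields_zero)
        moreover have "a 0 *\<^sub>R homogeneous 0 0 = (\<lambda>k. if k \<in> {} then a k *\<^sub>R s k else 0)"
          by (auto simp: homogeneous_def fun_eq_iff)
        ultimately show ?case
          unfolding z using homogeneous_in_symbols[OF sym_fields_zero, of 0] by (simp only: simp_thms)
      next
        case (insert j F)
        have sj: "s j \<in> sym_fields j" using s by (simp add: symbols_def)
        have split: "(\<lambda>k. if k \<in> insert j F then s k else 0) =
            homogeneous j (s j) + (\<lambda>k. if k \<in> F then s k else 0)"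
          using insert.hyps by (auto simp: homogeneous_def fun_eq_iff)
        have "a j *\<^sub>R homogeneous j (s j) + (\<lambda>k. if k \<in> F then a k *\<^sub>R s k else 0) =
            (\<lambda>k. if k \<in> insert j F then a k *\<^sub>R s k else 0)"
          using insert.hyps by (auto simp: homogeneous_def fun_eq_iff)
        then show ?case
          unfolding split using insert.IH
          by (simp only: symbols_add homogeneous_in_symbols[OF sj] G_add a[OF sj] simp_thms)
      qed
      have fin: "finite {k. s k \<noteq> 0}" using s by (simp add: symbols_def)
      have e1: "(\<lambda>k. if k \<in> {k. s k \<noteq> 0} then s k else 0) = s" by (auto simp: fun_eq_iff)
      have e2: "(\<lambda>k. if k \<in> {k. s k \<noteq> 0} then a k *\<^sub>R s k else 0) = (\<lambda>k. a k *\<^sub>R s k)"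
        by (rule ext) simp
      show ?thesis using part[OF fin] unfolding e1 e2 by (rule conjunct2)
    qed
    have "T (lie_operator lam mu X A) = lie_operator lam' mu' X (T A)"
      if X: "X \<in> sl_fields" and A: "A \<in> diffops" for X A
    proof (rule S'.symbol_inj)
      note s = S.symbol_in[OF A]
      have TG: "\<sigma>' (T B) = G (\<sigma> B)" if "B \<in> diffops" for B
        by (simp only: G_def S.inv_symbol_symbol[OF that])
      show "T (lie_operator lam mu X A) \<in> diffops" by (intro T_in S.lie_in_diffops X A)
      show "lie_operator lam' mu' X (T A) \<in> diffops" by (intro S'.lie_in_diffops T_in X A)
      have "\<sigma>' (T (lie_operator lam mu X A)) = G (\<sigma> (lie_operator lam mu X A))"
        by (rule TG) (rule S.lie_in_diffops[OF X A])
      also have "\<dots> = (\<lambda>k. a k *\<^sub>R lie_tensor \<delta> X (\<sigma> A k))"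
        using G[OF S.symbol_in[OF S.lie_in_diffops[OF X A]]]
        by (simp only: S.symbol_lie[OF X A] lie_symbol_def)
      also have "\<dots> = lie_symbol \<delta> X (\<sigma>' (T A))"
      proof
        fix k
        have "\<sigma> A k \<in> sym_fields k" using s by (simp add: symbols_def)
        then show "a k *\<^sub>R lie_tensor \<delta> X (\<sigma> A k) = lie_symbol \<delta> X (\<sigma>' (T A)) k"
          unfolding TG[OF A] G[OF s] lie_symbol_def by (simp only: lie_tensor_scaleR)
      qed
      also have "\<dots> = \<sigma>' (lie_operator lam' mu' X (T A))"
        by (simp only: S'.symbol_lie[OF X T_in[OF A]])
      finally show "\<sigma>' (T (lie_operator lam mu X A)) = \<sigma>' (lie_operator lam' mu' X (T A))" .
    qed
    then show "sl_equivariant_op lam mu lam' mu' T"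
      unfolding sl_equivariant_op_def by blast
  qed
  then show ?thesis unfolding G_def .
qed

end
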